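(* For any $\alpha,\tau>0$, there exist constants $\gamma_{\alpha,\tau}\in(0,1/2]$ and $C>0$ depending only on $\alpha$ and $\tau$ such that, for every $d\ge1$, every $\eta\in\mathbb{R}^d$ with $|\eta_1|\ge\cdots\ge|\eta_d|>0$, every $\sigma>0$ and every integer $s$ with $1\le s<\lfloor\gamma_{\alpha,\tau}d\rfloor/4$, the estimator $$\hat L_s'=\sum_{j\le j_1(s)}\eta_jy_j+\sum_{j>j_1(s)}\eta_jy_j\,\mathbf 1\big\{|\eta_jy_j|>\sqrt2\,\hat\sigma\,\tau\,\lambda_o\big\}$$ (which does not use the value of $\sigma$) satisfies $$\sup_{\theta\in\Theta_s}\ \sup_{\mathcal P_\xi\in\mathcal G_{\alpha,\tau}^{\otimes}}\mathbb{E}_{\theta,\mathcal P_\xi}\big(\hat L_s'-L(\theta)\big)^2\ \le\ C\,\sigma^2\,\Phi_{\rm o}(s;\eta).$$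
   Context: Model: $[d]=\{1,\dots,d\}$; $\eta\in\mathbb{R}^d$ is known with $|\eta_1|\ge\cdots\ge|\eta_d|>0$; one observes $y_j=\theta_j+\sigma\xi_j$, $j\in[d]$, with $\theta\in\mathbb{R}^d$ unknown, $\sigma>0$ unknown, and $\xi_1,\dots,\xi_d$ independent with joint law $\mathcal P_\xi$; $\mathbb{E}_{\theta,\mathcal P_\xi}$ is the corresponding expectation. $L(\theta)=\sum_{j=1}^d\eta_j\theta_j$, $\Theta_s=\{\theta\in\mathbb{R}^d:\#\{j:\theta_j\ne0\}\le s\}$. Noise class: $\mathcal G_{\alpha,\tau}$ is the class of laws on $\mathbb{R}$ of random variables $W$ symmetric around $0$ with $\mathbb{E}(W^2)=1$ and $\mathbb{P}(|W|\ge t)\le2\exp\{-2(t/\tau)^\alpha\}$ for all $t\ge0$; $\mathcal G_{\alpha,\tau}^{\otimes}=\{\otimes_{j=1}^dP_j:P_j\in\mathcal G_{\alpha,\tau}\}$. Rate: $\beta\in\mathbb{R}$ is the unique solution of $\sum_{j=1}^d|\eta_j|e^{-\beta/|\eta_j|^\alpha}\big/\sqrt{\sum_{j=1}^d\eta_j^2e^{-\beta/|\eta_j|^\alpha}}=s/2$; $\lambda_o=(\max(\beta,0))^{1/\alpha}$, $\nu=\sqrt{\sum_{j=1}^d\eta_j^2\exp(-(\lambda_o/|\eta_j|)^\alpha)}$, $\Phi_{\rm o}(s;\eta)=(\lambda_os+\nu)^2$, $j_1(s)=\max\{j\in[d]:|\eta_j|\ge\lambda_o\}$ ($0$ if no such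 $j$). Variance estimator (median of means): let $m=\lfloor\gamma_{\alpha,\tau}d\rfloor$ and fix a deterministic partition of $\{1,\dots,d\}$ into $m$ disjoint subsets $B_1,\dots,B_m$, each of cardinality $|B_i|\ge k:=\lfloor d/m\rfloor$. Then $\hat\sigma^2=\operatorname{median}(\bar\sigma_1^2,\dots,\bar\sigma_m^2)$ with $\bar\sigma_i^2=|B_i|^{-1}\sum_{j\in B_i}y_j^2$, and $\hat\sigma=\sqrt{\hat\sigma^2}$. *)

theory Defs
  imports "HOL-Probability.Probability"
begin

text \<open>
  Vectors of \<open>\<real>\<^sup>d\<close> are functions on \<open>nat\<close>, of which only the values on \<open>{1..d}\<close> matter.
\<close>

definition noise_class :: "real \<Rightarrow> real \<Rightarrow> real measure set" where
  "noise_class \<alpha> \<tau> =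
    {P. prob_space P \<and> sets P = sets borel
      \<and> distr P borel uminus = P
      \<and> integrable P (\<lambda>w. w\<^sup>2) \<and> (LINT w|P. w\<^sup>2) = 1
      \<and> (\<forall>t\<ge>0. measure P {w. \<bar>w\<bar> \<ge> t} \<le> 2 * exp (- 2 * (t / \<tau>) powr \<alpha>))}"

definition product_noise_class :: "real \<Rightarrow> real \<Rightarrow> nat \<Rightarrow> (nat \<Rightarrow> real) measure set" where
  "product_noise_class \<alpha> \<tau> d = {PiM {1..d} P | P. \<forall>j\<in>{1..d}. P j \<in> noise_class \<alpha> \<tau>}"

definition sparse_vectors :: "nat \<Rightarrow> nat \<Rightarrow> (nat \<Rightarrow> real) set" where
  "sparse_vectors d s = {\<theta>. card {j\<in>{1..d}. \<theta> j \<noteq> 0} \<le> s}"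

definition linear_functional :: "(nat \<Rightarrow> real) \<Rightarrow> nat \<Rightarrow> (nat \<Rightarrow> real) \<Rightarrow> real" where
  "linear_functional \<eta> d \<theta> = (\<Sum>j=1..d. \<eta> j * \<theta> j)"

definition observation :: "real \<Rightarrow> (nat \<Rightarrow> real) \<Rightarrow> (nat \<Rightarrow> real) \<Rightarrow> nat \<Rightarrow> real" where
  "observation \<sigma> \<theta> \<xi> = (\<lambda>j. \<theta> j + \<sigma> * \<xi> j)"

text \<open>
  For \<open>\<alpha> > 0\<close>, \<open>d \<ge> 1\<close>, \<open>s \<ge> 1\<close> and nonzero coefficients, the left-hand side below is a
  continuous, strictly decreasing bijection from the reals in \<open>b\<close> onto the positive reals,
  so the description is proper.
\<close>

definition rate_beta :: "real \<Rightarrow> (nat \<Rightarrow> real) \<Rightarrow> nat \<Rightarrow> nat \<Rightarrow> real" where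
  "rate_beta \<alpha> \<eta> d s =
    (THE b. (\<Sum>j=1..d. \<bar>\<eta> j\<bar> * exp (- b / \<bar>\<eta> j\<bar> powr \<alpha>))
              / sqrt (\<Sum>j=1..d. (\<eta> j)\<^sup>2 * exp (- b / \<bar>\<eta> j\<bar> powr \<alpha>))
            = real s / 2)"

definition rate_lambda :: "real \<Rightarrow> (nat \<Rightarrow> real) \<Rightarrow> nat \<Rightarrow> nat \<Rightarrow> real" where
  "rate_lambda \<alpha> \<eta> d s = (max (rate_beta \<alpha> \<eta> d s) 0) powr (1 / \<alpha>)"

definition rate_nu :: "real \<Rightarrow> (nat \<Rightarrow> real) \<Rightarrow> nat \<Rightarrow> nat \<Rightarrow> real" where
  "rate_nu \<alpha> \<eta> d s =
    sqrt (\<Sum>j=1..d. (\<eta> j)\<^sup>2 * exp (- ((rate_lambda \<alpha> \<eta> d s / \<bar>\<eta> j\<bar>) powr \<alpha>)))"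

definition rate_Phi :: "real \<Rightarrow> (nat \<Rightarrow> real) \<Rightarrow> nat \<Rightarrow> nat \<Rightarrow> real" where
  "rate_Phi \<alpha> \<eta> d s = (rate_lambda \<alpha> \<eta> d s * real s + rate_nu \<alpha> \<eta> d s)\<^sup>2"

definition cutoff_index :: "real \<Rightarrow> (nat \<Rightarrow> real) \<Rightarrow> nat \<Rightarrow> nat \<Rightarrow> nat" where
  "cutoff_index \<alpha> \<eta> d s = Max (insert 0 {j\<in>{1..d}. \<bar>\<eta> j\<bar> \<ge> rate_lambda \<alpha> \<eta> d s})"

text \<open>
  Sample median; for an even number of values, the mean of the two middle order statistics.
\<close>

definition sample_median :: "real list \<Rightarrow> real" where
  "sample_median xs =
    (let ys = sort xs; n = length xs in
      if odd n then ys ! (n div 2) else (ys ! (n div 2 - 1) + ys ! (n div 2)) / 2)"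

definition block_partition :: "nat \<Rightarrow> nat \<Rightarrow> (nat \<Rightarrow> nat set) \<Rightarrow> bool" where
  "block_partition d m B \<longleftrightarrow>
    disjoint_family_on B {1..m} \<and> (\<Union>i\<in>{1..m}. B i) = {1..d}
    \<and> (\<forall>i\<in>{1..m}. card (B i) \<ge> d div m)"

definition block_mean_square :: "nat set \<Rightarrow> (nat \<Rightarrow> real) \<Rightarrow> real" where
  "block_mean_square A y = (\<Sum>j\<in>A. (y j)\<^sup>2) / real (card A)"

definition sigma_hat :: "nat \<Rightarrow> (nat \<Rightarrow> nat set) \<Rightarrow> (nat \<Rightarrow> real) \<Rightarrow> real" where
  "sigma_hat m B y = sqrt (sample_median (map (\<lambda>i. block_mean_square (B i) y) [1..<Suc m]))"

definition L_hat ::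
  "real \<Rightarrow> real \<Rightarrow> (nat \<Rightarrow> real) \<Rightarrow> nat \<Rightarrow> nat \<Rightarrow> nat \<Rightarrow> (nat \<Rightarrow> nat set) \<Rightarrow> (nat \<Rightarrow> real) \<Rightarrow> real" where
  "L_hat \<alpha> \<tau> \<eta> d s m B y =
    (\<Sum>j\<in>{1..cutoff_index \<alpha> \<eta> d s}. \<eta> j * y j)
    + (\<Sum>j\<in>{cutoff_index \<alpha> \<eta> d s<..d}. \<eta> j * y j *
        of_bool (\<bar>\<eta> j * y j\<bar> > sqrt 2 * sigma_hat m B y * \<tau> * rate_lambda \<alpha> \<eta> d s))"

end

theory Submission
  imports Defs "HOL-Real_Asymp.Real_Asymp"
begin

text \<open>
  The error splits into the untruncated coordinates \<open>j \<le> j\<^sub>1(s)\<close>, the support of \<open>\<theta>\<close> and the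
  thresholded pure noise. On the support each term costs at most the threshold plus the noise.
  Off the support the threshold depends on each \<open>\<xi>\<^sub>j\<close> only through \<open>\<xi>\<^sub>j\<^sup>2\<close>, so by symmetry the
  thresholded noise terms are uncorrelated, although they all involve
  the estimate of \<open>\<sigma>\<close>.
  More than three quarters of the blocks contain no support point. Hence the median of means is at
  most \<open>4 \<sigma>\<^sup>2\<close> in expectation, by counting, and it is below \<open>\<sigma>\<^sup>2 / 2\<close> only if a quarter of
  the blocks are clean with a small mean, which has probability at most \<open>exp (- m)\<close>.
\<close>

section \<open>Order statistics and the sample median\<close>

text \<open>The threshold is computed from the same observations that it cuts, so the terms are
  dependent and the noise level is controlled only with high probability. When the level is too low,
  each of the up to \<open>d\<close> noise terms costs at most a multiple of
  \<open>lam\<^sup>2 * exp (- m / 2)\<close>, with \<open>m\<close> the number of blocks. As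
  \<open>m\<close> is proportional to \<open>d\<close>, the product \<open>d * exp (- m / 2)\<close>
  stays bounded, and a multiple of \<open>lam\<^sup>2\<close> is left, which \<open>rate_Phi\<close>
  dominates. The constants: \<open>K\<close> bounds all fourth moments in the class. With at least
  \<open>128 * K\<close> points per block, a given quarter of the blocks, all clean, has small means
  with probability at most \<open>exp (- 2 * m)\<close>, which beats the \<open>2 ^ m\<close>
  choices of the quarter. This forces \<gamma> to be about \<open>1 / (128 * K)\<close>. The
  \<open>sqrt 2\<close> in the threshold compensates for the level
  \<open>\<sigma>\<^sup>2 / 2\<close>. Half of the factor 2 in the tail exponent of the class is
  spent on passing from probabilities to second moments; the other half yields the weights in
  \<open>rate_nu\<close>.\<close>

lemma length_filter_sort:
  fixes xs :: "'a::linorder list"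
  shows "length (filter P (sort xs)) = length (filter P xs)"
  using filter_sort[of P "\<lambda>x. x" xs] by simp

text \<open>In the sorted list the entries that are at most \<open>c\<close> form an initial
  segment, so a statement about an order statistic becomes one about a count. This serves the median
  and its measurability.\<close>

lemma sort_nth_le_iff:
  fixes xs :: "'a::linorder list"
  assumes "k < length xs"
  shows "sort xs ! k \<le> c \<longleftrightarrow> k < length (filter (\<lambda>x. x \<le> c) xs)"
proof -
  have len: "length (filter (\<lambda>x. x \<le> c) xs) = length (filter (\<lambda>x. x \<le> c) (sort xs))"
    by (simp add: length_filter_sort)
  have card: "length (filter (\<lambda>x. x \<le> c) (sort xs)) = card {i. i < length xs \<and> sort xs ! i \<le> c}"
    by (simp add: length_filter_conv_card)
  show ?thesis
  proof
    assume le: "sort xs ! k \<le> c"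
    have "sort xs ! i \<le> c" if "i \<le> k" for i
      using sorted_nth_mono[OF sorted_sort, of i k xs] le that assms by auto
    then have "{..k} \<subseteq> {i. i < length xs \<and> sort xs ! i \<le> c}"
      using assms by auto
    from card_mono[OF _ this] show "k < length (filter (\<lambda>x. x \<le> c) xs)"
      by (simp add: len card)
  next
    assume k: "k < length (filter (\<lambda>x. x \<le> c) xs)"
    show "sort xs ! k \<le> c"
    proof (rule ccontr)
      assume gt: "\<not> sort xs ! k \<le> c"
      have "i < k" if "i < length xs" "sort xs ! i \<le> c" for i
        using sorted_nth_mono[OF sorted_sort, of k i xs] gt that by (cases "k \<le> i") auto
      then have "{i. i < length xs \<and> sort xs ! i \<le> c} \<subseteq> {..<k}" by auto
      from card_mono[OF _ this] show False using k by (simp add: len card)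
    qed
  qed
qed

text \<open>The two indices are the middle positions, counted from 0; they coincide for odd length,
  so both parities are treated at once.\<close>

lemma sample_median_bounds:
  assumes "xs \<noteq> []"
  shows "sort xs ! ((length xs - 1) div 2) \<le> sample_median xs"
    and "sample_median xs \<le> sort xs ! (length xs div 2)"
proof -
  let ?n = "length xs"
  have n: "?n > 0" using assms by simp
  have mono: "sort xs ! ((?n - 1) div 2) \<le> sort xs ! (?n div 2)"
    using n by (intro sorted_nth_mono) auto
  have "even ?n \<Longrightarrow> (?n - 1) div 2 = ?n div 2 - 1" "odd ?n \<Longrightarrow> (?n - 1) div 2 = ?n div 2"
    by presburger+
  then show "sort xs ! ((length xs - 1) div 2) \<le> sample_median xs"
    and "sample_median xs \<le> sort xs ! (length xs div 2)"
    using mono by (cases "even ?n"; simp add: sample_median_def Let_def)+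
qed

lemma half_le_sample_median:
  assumes "xs \<noteq> []"
  shows "length xs \<le> 2 * length (filter (\<lambda>x. x \<le> sample_median xs) xs)"
proof -
  have "(length xs - 1) div 2 < length xs" using assms by (cases xs) auto
  from sort_nth_le_iff[OF this, of "sample_median xs"] sample_median_bounds(1)[OF assms]
  have "(length xs - 1) div 2 < length (filter (\<lambda>x. x \<le> sample_median xs) xs)" by simp
  then show ?thesis by linarith
qed

lemma half_ge_sample_median:
  assumes "xs \<noteq> []"
  shows "length xs \<le> 2 * length (filter (\<lambda>x. sample_median xs \<le> x) xs)"
proof -
  have len: "length (filter (\<lambda>x. sample_median xs \<le> x) xs) = card {i. i < length xs \<and> sample_median xs \<le> sort xs ! i}"
    using length_filter_conv_card[of "\<lambda>x. sample_median xs \<le> x" "sort xs"] by (simp add: length_filter_sort)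
  have "sample_median xs \<le> sort xs ! i" if "length xs div 2 \<le> i" "i < length xs" for i
    using sample_median_bounds(2)[OF assms] sorted_nth_mono[OF sorted_sort, of "length xs div 2" i xs] that
    by simp
  then have "{length xs div 2..<length xs} \<subseteq> {i. i < length xs \<and> sample_median xs \<le> sort xs ! i}"
    by auto
  from card_mono[OF _ this] have "length xs - length xs div 2 \<le> length (filter (\<lambda>x. sample_median xs \<le> x) xs)"
    by (simp add: len)
  then show ?thesis by linarith
qed

text \<open>Counting indices rather than values keeps multiplicities: blocks with equal means count
  separately.\<close>

lemma length_filter_map_upt:
  "length (filter P (map f [1..<Suc m])) = card {i \<in> {1..m}. P (f i)}"
proof -
  have "length (filter P (map f [1..<Suc m])) = card (set (filter (\<lambda>i. P (f i)) [1..<Suc m]))"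
    by (subst distinct_card) (simp_all add: filter_map o_def del: upt_Suc)
  also have "set (filter (\<lambda>i. P (f i)) [1..<Suc m]) = {i \<in> {1..m}. P (f i)}" by auto
  finally show ?thesis .
qed

lemma sample_median_nonneg:
  assumes "xs \<noteq> []" and "\<And>x. x \<in> set xs \<Longrightarrow> 0 \<le> x"
  shows "0 \<le> sample_median xs"
proof -
  have "(length xs - 1) div 2 < length (sort xs)" using assms(1) by (cases xs) auto
  then have "sort xs ! ((length xs - 1) div 2) \<in> set xs"
    using nth_mem[of "(length xs - 1) div 2" "sort xs"] by simp
  from assms(2)[OF this] sample_median_bounds(1)[OF assms(1)] show ?thesis by linarith
qed

text \<open>The \<open>k\<close>-th order statistic is at most \<open>c\<close> iff more than
  \<open>k\<close> entries are, so its sublevel sets are described by a finite sum of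
  indicators.\<close>

lemma borel_measurable_sort_nth:
  fixes f :: "'i \<Rightarrow> 'a \<Rightarrow> real"
  assumes "\<And>i. i \<in> set is \<Longrightarrow> f i \<in> borel_measurable M" and "k < length is"
  shows "(\<lambda>x. sort (map (\<lambda>i. f i x) is) ! k) \<in> borel_measurable M"
proof (rule borel_measurable_iff_le[THEN iffD2], intro allI)
  fix c
  have count: "real (length (filter (\<lambda>y. y \<le> c) (map (\<lambda>i. f i x) js))) = (\<Sum>i\<leftarrow>js. of_bool (f i x \<le> c))"
    for x js by (induction js) auto
  have meas: "(\<lambda>x. \<Sum>i\<leftarrow>js. of_bool (f i x \<le> c) :: real) \<in> borel_measurable M"
    if "set js \<subseteq> set is" for js
    using that
  proof (induction js)
    case (Cons j js)
    have [measurable]: "f j \<in> borel_measurable M" using Cons.prems assms(1) by auto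
    have [measurable]: "(\<lambda>x. \<Sum>i\<leftarrow>js. of_bool (f i x \<le> c) :: real) \<in> borel_measurable M"
      using Cons by auto
    show ?case unfolding list.map sum_list.Cons by measurable
  qed simp
  note meas[OF order_refl, measurable]
  have "{x \<in> space M. sort (map (\<lambda>i. f i x) is) ! k \<le> c}
      = {x \<in> space M. real k < (\<Sum>i\<leftarrow>is. of_bool (f i x \<le> c))}"
    using assms(2) by (simp add: sort_nth_le_iff flip: count)
  also have "\<dots> \<in> sets M" by measurable
  finally show "{x \<in> space M. sort (map (\<lambda>i. f i x) is) ! k \<le> c} \<in> sets M" .
qed

lemma borel_measurable_sample_median:
  fixes f :: "'i \<Rightarrow> 'a \<Rightarrow> real"
  assumes "\<And>i. i \<in> set is \<Longrightarrow> f i \<in> borel_measurable M" and "is \<noteq> []"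
  shows "(\<lambda>x. sample_median (map (\<lambda>i. f i x) is)) \<in> borel_measurable M"
proof -
  have nth: "(\<lambda>x. sort (map (\<lambda>i. f i x) is) ! k) \<in> borel_measurable M" if "k < length is" for k
    using borel_measurable_sort_nth[OF assms(1) that] .
  have "length is div 2 < length is" "length is div 2 - 1 < length is"
    using assms(2) by (cases "is"; auto)+
  note [measurable] = this[THEN nth]
  show ?thesis
    by (cases "odd (length is)"; simp only: sample_median_def Let_def length_map if_True if_False; measurable)
qed

section \<open>Fourth moments of the noise class\<close>

lemma summable_polynomial_times_stretched_exp:
  fixes a \<tau> :: real
  assumes "a > 0" "\<tau> > 0"
  shows "summable (\<lambda>n. (real n + 1) ^ 4 * (2 * exp (- 2 * (real n / \<tau>) powr a)))"
proof (rule summable_comparison_test_bigo)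
  show "summable (\<lambda>n. norm (1 / (real n) ^ 2))"
    using inverse_power_summable[of 2, where 'a = real] by (simp add: inverse_eq_divide)
  show "(\<lambda>n. (real n + 1) ^ 4 * (2 * exp (- 2 * (real n / \<tau>) powr a))) \<in> O(\<lambda>n. 1 / (real n) ^ 2)"
    using assms by real_asymp
qed

text \<open>The layer whose \<open>n\<close> is the integer part of the absolute value of
  \<open>w\<close> suffices. Integrating the series produces the tail probabilities that
  \<open>noise_class\<close> bounds.\<close>

lemma fourth_power_le_layers:
  fixes w :: real
  shows "ennreal (w ^ 4) \<le> (\<Sum>n. ennreal ((real n + 1) ^ 4) * indicator {v. real n \<le> \<bar>v\<bar>} w)"
proof -
  define n where "n = nat \<lfloor>\<bar>w\<bar>\<rfloor>"
  have n: "real n \<le> \<bar>w\<bar>" "\<bar>w\<bar> \<le> real n + 1" by (auto simp: n_def)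
  have "w ^ 4 \<le> (real n + 1) ^ 4"
    using power_mono[OF n(2), of 4] by simp
  then have "ennreal (w ^ 4) \<le> ennreal ((real n + 1) ^ 4) * indicator {v. real n \<le> \<bar>v\<bar>} w"
    using n by (simp add: ennreal_leI)
  also have "\<dots> = (\<Sum>k\<in>{n}. ennreal ((real k + 1) ^ 4) * indicator {v. real k \<le> \<bar>v\<bar>} w)"
    by (simp only: sum.empty sum.insert finite.emptyI empty_iff not_False_eq_True add_0_right)
  also have "\<dots> \<le> (\<Sum>k. ennreal ((real k + 1) ^ 4) * indicator {v. real k \<le> \<bar>v\<bar>} w)"
    by (rule sum_le_suminf) auto
  finally show ?thesis .
qed

text \<open>\<open>K\<close> is chosen before \<open>P\<close>; this is what makes every later
  constant uniform over the class.\<close>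

lemma noise_class_fourth_moment:
  fixes \<alpha> \<tau> :: real
  assumes "\<alpha> > 0" "\<tau> > 0"
  obtains K where "1 \<le> K"
    and "\<And>P. P \<in> noise_class \<alpha> \<tau> \<Longrightarrow> integrable P (\<lambda>w. w ^ 4)"
    and "\<And>P. P \<in> noise_class \<alpha> \<tau> \<Longrightarrow> (LINT w|P. w ^ 4) \<le> K"
proof
  let ?f = "\<lambda>n. (real n + 1) ^ 4 * (2 * exp (- 2 * (real n / \<tau>) powr \<alpha>))"
  define K where "K = max 1 (\<Sum>n. ?f n)"
  show "1 \<le> K" by (simp add: K_def)
  fix P assume P: "P \<in> noise_class \<alpha> \<tau>"
  interpret prob_space P using P by (simp add: noise_class_def)
  have [measurable_cong]: "sets P = sets borel" using P by (simp add: noise_class_def)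
  have "(\<integral>\<^sup>+w. ennreal (w ^ 4) \<partial>P)
      \<le> (\<integral>\<^sup>+w. (\<Sum>n. ennreal ((real n + 1) ^ 4) * indicator {v. real n \<le> \<bar>v\<bar>} w) \<partial>P)"
    by (intro nn_integral_mono fourth_power_le_layers)
  also have "\<dots> = (\<Sum>n. \<integral>\<^sup>+w. ennreal ((real n + 1) ^ 4) * indicator {v. real n \<le> \<bar>v\<bar>} w \<partial>P)"
    by (rule nn_integral_suminf) measurable
  also have "\<dots> = (\<Sum>n. ennreal ((real n + 1) ^ 4 * prob {v. real n \<le> \<bar>v\<bar>}))"
    by (simp add: nn_integral_cmult_indicator emeasure_eq_measure ennreal_mult)
  also have "\<dots> \<le> (\<Sum>n. ennreal (?f n))"
  proof (intro suminf_le ennreal_leI mult_left_mono)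
    show "prob {v. real n \<le> \<bar>v\<bar>} \<le> 2 * exp (- 2 * (real n / \<tau>) powr \<alpha>)" for n
      using P by (simp add: noise_class_def)
  qed auto
  also have "\<dots> = ennreal (\<Sum>n. ?f n)"
    by (intro suminf_ennreal2 summable_polynomial_times_stretched_exp assms) auto
  also have "\<dots> \<le> ennreal K"
    by (intro ennreal_leI) (simp add: K_def)
  finally have le: "(\<integral>\<^sup>+w. ennreal (w ^ 4) \<partial>P) \<le> ennreal K" .
  then show int: "integrable P (\<lambda>w. w ^ 4)"
    by (intro integrableI_nonneg) (auto simp: ennreal_less_top intro: le_less_trans)
  from le show "(LINT w|P. w ^ 4) \<le> K"
    using \<open>1 \<le> K\<close> by (simp add: nn_integral_eq_integral[OF int])
qed

section \<open>Symmetric product noise\<close>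

(* keeps the simplifier from turning {1..d} into {Suc 0..d} *)
declare One_nat_def [simp del]

text \<open>The law at every index is constrained, not only on \<open>{1..d}\<close>, because the
  product locale wants a probability space at each index. The laws enter the constants only through
  \<open>K\<close>.\<close>

locale product_noise =
  fixes P :: "nat \<Rightarrow> real measure" and d :: nat and \<alpha> \<tau> K :: real
  assumes noise: "\<And>j. P j \<in> noise_class \<alpha> \<tau>"
    and K_ge_1: "1 \<le> K"
    and integrable_fourth: "\<And>j. integrable (P j) (\<lambda>w. w ^ 4)"
    and fourth_moment_le: "\<And>j. (LINT w|P j. w ^ 4) \<le> K"

sublocale product_noise \<subseteq> finite_product_prob_space P "{1..d}"
proof -
  have "prob_space (P j)" for j using noise[of j] by (simp add: noise_class_def)
  then interpret product_prob_space P by (rule product_prob_spaceI)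
  show "finite_product_prob_space P {1..d}" by unfold_locales simp
qed

context product_noise
begin

abbreviation "\<Q> \<equiv> PiM {1..d} P"

lemma sets_noise [measurable_cong, simp]: "sets (P j) = sets borel"
  using noise[of j] by (simp add: noise_class_def)

lemma space_noise [simp]: "space (P j) = UNIV"
  using sets_eq_imp_space_eq[OF sets_noise] by simp

lemma noise_UNIV [simp]: "measure (P j) UNIV = 1"
  using M.prob_space[of j] by simp

section \<open>Marginal laws of the coordinates\<close>

lemma component_measurable [measurable]: "j \<in> {1..d} \<Longrightarrow> (\<lambda>\<xi>. \<xi> j) \<in> borel_measurable \<Q>"
  using measurable_component_singleton[of j "{1..d}" P]
  by (simp add: measurable_cong_sets[OF refl sets_noise])

lemma distr_component: "j \<in> {1..d} \<Longrightarrow> distr \<Q> borel (\<lambda>\<xi>. \<xi> j) = P j"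
  using distr_PiM_component[of "{1..d}" P j] M.prob_space_axioms
  by (simp cong: distr_cong)

lemma integral_component:
  fixes f :: "real \<Rightarrow> real"
  assumes "j \<in> {1..d}" "f \<in> borel_measurable borel"
  shows "(LINT \<xi>|\<Q>. f (\<xi> j)) = (LINT w|P j. f w)"
  by (subst distr_component[OF assms(1), symmetric])
    (rule integral_distr[symmetric, OF component_measurable[OF assms(1)] assms(2)])

lemma integrable_component:
  fixes f :: "real \<Rightarrow> real"
  assumes "j \<in> {1..d}" "integrable (P j) f"
  shows "integrable \<Q> (\<lambda>\<xi>. f (\<xi> j))"
proof -
  have "f \<in> borel_measurable borel"
    using borel_measurable_integrable[OF assms(2)] by (simp add: measurable_cong_sets[OF sets_noise refl])
  then show ?thesis
    using assms(2) integrable_distr_eq[OF component_measurable[OF assms(1)], of f]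
    unfolding distr_component[OF assms(1)] by simp
qed

section \<open>Variance and sign symmetry of the coordinates\<close>

lemma integrable_square: "integrable (P j) (\<lambda>w. w\<^sup>2)"
  and second_moment: "(LINT w|P j. w\<^sup>2) = 1"
  using noise[of j] by (simp_all add: noise_class_def)

text \<open>Symmetry gives \<open>I = - I\<close> for the integral \<open>I\<close>, also for a
  non-integrable \<open>f\<close>, whose integral is 0 by convention. Hence inner integrals in
  Fubini's theorem vanish at every point, not just almost everywhere.\<close>

lemma integral_odd:
  fixes f :: "real \<Rightarrow> real"
  assumes [measurable]: "f \<in> borel_measurable borel" and odd: "\<And>w. f (- w) = - f w"
  shows "(LINT w|P j. f w) = 0"
proof -
  have "(LINT w|P j. f w) = (LINT w|distr (P j) borel uminus. f w)"
    using noise[of j] by (simp add: noise_class_def)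
  also have "\<dots> = (LINT w|P j. f (- w))"
    by (rule integral_distr) (auto simp: measurable_cong_sets[OF sets_noise refl])
  also have "\<dots> = - (LINT w|P j. f w)" by (simp add: odd)
  finally show ?thesis by simp
qed

text \<open>Coordinate \<open>j\<close> is integrated first, with the others fixed. The dependence
  of \<open>f\<close> on the other coordinates is arbitrary, so \<open>f\<close> may contain a
  threshold built from all of them.\<close>

lemma integral_odd_component:
  fixes f :: "(nat \<Rightarrow> real) \<Rightarrow> real"
  assumes "j \<in> {1..d}" and f: "integrable \<Q> f"
    and odd: "\<And>\<xi>. f (\<xi>(j := - \<xi> j)) = - f \<xi>"
  shows "(LINT \<xi>|\<Q>. f \<xi>) = 0"
proof -
  define I where "I = {1..d} - {j}"
  have I: "finite I" "j \<notin> I" "insert j I = {1..d}" using assms(1) by (auto simp: I_def)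
  have "(LINT \<xi>|\<Q>. f \<xi>) = (LINT \<xi>|PiM I P. (LINT w|P j. f (\<xi>(j := w))))"
    using product_integral_insert[of I j f] I f by simp
  also have "\<dots> = (LINT \<xi>|PiM I P. 0)"
  proof (rule Bochner_Integration.integral_cong[OF refl])
    fix \<xi> assume \<xi>: "\<xi> \<in> space (PiM I P)"
    have fb: "f \<in> borel_measurable (PiM (insert j I) P)" using f I by auto
    have "(\<lambda>w. f (\<xi>(j := w))) \<in> borel_measurable (P j)"
      using measurable_comp[OF measurable_component_update fb, OF \<xi> I(2)] unfolding comp_def .
    then have "(\<lambda>w. f (\<xi>(j := w))) \<in> borel_measurable borel"
      by (simp add: measurable_cong_sets[OF sets_noise refl])
    then show "(LINT w|P j. f (\<xi>(j := w))) = 0"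
      by (rule integral_odd) (use odd[of "\<xi>(j := w)" for w] in simp)
  qed
  finally show ?thesis by simp
qed

text \<open>For distinct \<open>j\<close> and \<open>k\<close> the product \<open>g j * g k\<close>
  is odd under the sign change of coordinate \<open>j\<close>, so the cross terms vanish although
  the \<open>g j\<close> may be dependent.\<close>

lemma integral_square_sum_odd:
  fixes g :: "nat \<Rightarrow> (nat \<Rightarrow> real) \<Rightarrow> real"
  assumes J: "J \<subseteq> {1..d}"
    and [measurable]: "\<And>j. j \<in> J \<Longrightarrow> g j \<in> borel_measurable \<Q>"
    and int: "\<And>j. j \<in> J \<Longrightarrow> integrable \<Q> (\<lambda>\<xi>. (g j \<xi>)\<^sup>2)"
    and odd: "\<And>j \<xi>. j \<in> J \<Longrightarrow> g j (\<xi>(j := - \<xi> j)) = - g j \<xi>"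
    and even: "\<And>j k \<xi>. j \<in> J \<Longrightarrow> k \<in> J \<Longrightarrow> j \<noteq> k \<Longrightarrow> g k (\<xi>(j := - \<xi> j)) = g k \<xi>"
  shows "integrable \<Q> (\<lambda>\<xi>. (\<Sum>j\<in>J. g j \<xi>)\<^sup>2)"
    and "(LINT \<xi>|\<Q>. (\<Sum>j\<in>J. g j \<xi>)\<^sup>2) = (\<Sum>j\<in>J. LINT \<xi>|\<Q>. (g j \<xi>)\<^sup>2)"
proof -
  have fin: "finite J" using J finite_subset by blast
  have prod_int: "integrable \<Q> (\<lambda>\<xi>. g j \<xi> * g k \<xi>)" if "j \<in> J" "k \<in> J" for j k
  proof (rule Bochner_Integration.integrable_bound)
    show "integrable \<Q> (\<lambda>\<xi>. (g j \<xi>)\<^sup>2 + (g k \<xi>)\<^sup>2)" using int that by simp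
    have "\<bar>a * b\<bar> \<le> a\<^sup>2 + b\<^sup>2" for a b :: real
      using sum_squares_bound[of "\<bar>a\<bar>" "\<bar>b\<bar>"] abs_ge_zero[of "a * b"]
      unfolding abs_mult power2_abs by linarith
    then show "AE \<xi> in \<Q>. norm (g j \<xi> * g k \<xi>) \<le> norm ((g j \<xi>)\<^sup>2 + (g k \<xi>)\<^sup>2)" by simp
  qed (use that in measurable)
  have sq: "(\<Sum>j\<in>J. g j \<xi>)\<^sup>2 = (\<Sum>j\<in>J. \<Sum>k\<in>J. g j \<xi> * g k \<xi>)" for \<xi>
    by (simp add: power2_eq_square sum_product)
  show "integrable \<Q> (\<lambda>\<xi>. (\<Sum>j\<in>J. g j \<xi>)\<^sup>2)"
    unfolding sq using prod_int by simp
  have cross: "(LINT \<xi>|\<Q>. g j \<xi> * g k \<xi>) = 0" if "j \<in> J" "k \<in> J" "j \<noteq> k" for j k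
    using that J by (intro integral_odd_component[of j] prod_int) (auto simp: odd even)
  have "(LINT \<xi>|\<Q>. (\<Sum>j\<in>J. g j \<xi>)\<^sup>2) = (\<Sum>j\<in>J. \<Sum>k\<in>J. LINT \<xi>|\<Q>. g j \<xi> * g k \<xi>)"
    unfolding sq using prod_int by simp
  also have "\<dots> = (\<Sum>j\<in>J. LINT \<xi>|\<Q>. (g j \<xi>)\<^sup>2)"
  proof (rule sum.cong[OF refl])
    fix j assume j: "j \<in> J"
    have "(\<Sum>k\<in>J. LINT \<xi>|\<Q>. g j \<xi> * g k \<xi>) = (\<Sum>k\<in>{j}. LINT \<xi>|\<Q>. g j \<xi> * g k \<xi>)"
      using j fin cross by (intro sum.mono_neutral_right) blast+
    then show "(\<Sum>k\<in>J. LINT \<xi>|\<Q>. g j \<xi> * g k \<xi>) = (LINT \<xi>|\<Q>. (g j \<xi>)\<^sup>2)"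
      by (simp add: power2_eq_square)
  qed
  finally show "(LINT \<xi>|\<Q>. (\<Sum>j\<in>J. g j \<xi>)\<^sup>2) = (\<Sum>j\<in>J. LINT \<xi>|\<Q>. (g j \<xi>)\<^sup>2)" .
qed

text \<open>A Chernoff weight against small squares: variance 1 and a bounded fourth moment keep the
  noise away from 0. The exponent reached is \<open>a\<^sup>2 * K - a / 2\<close>; it is smallest at
  \<open>a = 1 / (4 * K)\<close>, with value \<open>- 1 / (16 * K)\<close>.\<close>

lemma tilted_integral_le:
  defines "a \<equiv> 1 / (4 * K)"
  shows "integrable (P j) (\<lambda>w. exp (a / 2 - a * w\<^sup>2))"
    and "(LINT w|P j. exp (a / 2 - a * w\<^sup>2)) \<le> exp (- 1 / (16 * K))"
proof -
  have a: "a > 0" using K_ge_1 by (simp add: a_def)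
  have K0: "K > 0" using K_ge_1 by simp
  show int: "integrable (P j) (\<lambda>w. exp (a / 2 - a * w\<^sup>2))"
    by (rule M.integrable_const_bound[where B = "exp (a / 2)"])
      (use a in \<open>auto simp: measurable_cong_sets[OF sets_noise refl]\<close>)
  have bound: "exp (a / 2 - a * w\<^sup>2) \<le> exp (a / 2) * (1 - a * w\<^sup>2 + a\<^sup>2 * w ^ 4)" for w
  proof -
    define x where "x = a * w\<^sup>2"
    have x: "x \<ge> 0" using a by (simp add: x_def)
    have "exp (- x) \<le> 1 / (1 + x)"
      using exp_ge_add_one_self[of x] x by (simp add: exp_minus field_simps)
    also have "\<dots> \<le> 1 - x + x\<^sup>2"
    proof -
      have "1 + x ^ 3 = (1 - x + x\<^sup>2) * (1 + x)" by algebra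
      with zero_le_power[OF x, of 3] have "1 \<le> (1 - x + x\<^sup>2) * (1 + x)" by linarith
      then show ?thesis using x by (simp add: divide_le_eq)
    qed
    finally have "exp (a / 2) * exp (- x) \<le> exp (a / 2) * (1 - x + x\<^sup>2)" by simp
    moreover have "x\<^sup>2 = a\<^sup>2 * w ^ 4" by (simp add: x_def power_mult_distrib flip: power_mult)
    moreover have "exp (a / 2 - a * w\<^sup>2) = exp (a / 2) * exp (- x)" by (simp add: x_def flip: exp_add)
    ultimately show ?thesis by (simp add: x_def)
  qed
  have i1: "integrable (P j) (\<lambda>w. a * w\<^sup>2)" and i2: "integrable (P j) (\<lambda>w. a\<^sup>2 * w ^ 4)"
    using integrable_square integrable_fourth by simp_all
  have "(LINT w|P j. exp (a / 2 - a * w\<^sup>2)) \<le> (LINT w|P j. exp (a / 2) * (1 - a * w\<^sup>2 + a\<^sup>2 * w ^ 4))"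
    using i1 i2 by (intro integral_mono int bound) auto
  also have "\<dots> = exp (a / 2) * (1 - a + a\<^sup>2 * (LINT w|P j. w ^ 4))"
    using i1 i2 integrable_square integrable_fourth by (simp add: second_moment)
  also have "\<dots> \<le> exp (a / 2) * (1 + (a\<^sup>2 * K - a))"
    using fourth_moment_le[of j] by (simp add: mult_left_mono)
  also have "\<dots> \<le> exp (a / 2) * exp (a\<^sup>2 * K - a)"
    by (intro mult_left_mono exp_ge_add_one_self) auto
  also have "\<dots> = exp (- 1 / (16 * K))"
    using K0 by (simp add: a_def field_simps power2_eq_square flip: exp_add)
  finally show "(LINT w|P j. exp (a / 2 - a * w\<^sup>2)) \<le> exp (- 1 / (16 * K))" .
qed

text \<open>Meant for \<open>t = \<tau> * lam / \<bar>\<eta> j\<bar>\<close>, where the exponential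
  on the right is the weight of coordinate \<open>j\<close> in \<open>rate_nu\<close>.\<close>

lemma tail_second_moment_le:
  assumes "j \<in> {1..d}" and "t \<ge> 0"
  shows "(LINT \<xi>|\<Q>. (\<xi> j)\<^sup>2 * of_bool (t \<le> \<bar>\<xi> j\<bar>)) \<le> (K / 2 + 1) * exp (- ((t / \<tau>) powr \<alpha>))"
proof -
  define u where "u = (t / \<tau>) powr \<alpha>"
  have pt: "w\<^sup>2 * of_bool (t \<le> \<bar>w\<bar>) \<le> w ^ 4 * (exp (- u) / 2) + indicator {w. t \<le> \<bar>w\<bar>} w * (exp u / 2)" for w
  proof -
    (* AM-GM; the tail exponent 2 u loses only one u to the weight *)
    have "2 * (w\<^sup>2 * exp (- u / 2)) * exp (u / 2) \<le> (w\<^sup>2 * exp (- u / 2))\<^sup>2 + (exp (u / 2))\<^sup>2"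
      by (rule sum_squares_bound)
    also have "2 * (w\<^sup>2 * exp (- u / 2)) * exp (u / 2) = 2 * w\<^sup>2"
      by (simp add: exp_minus)
    also have "(w\<^sup>2 * exp (- u / 2))\<^sup>2 = w ^ 4 * exp (- u)"
      by (simp add: power_mult_distrib flip: power_mult exp_of_nat_mult)
    also have "(exp (u / 2))\<^sup>2 = exp u"
      by (simp flip: exp_of_nat_mult)
    finally have "2 * w\<^sup>2 \<le> w ^ 4 * exp (- u) + exp u" .
    then show ?thesis by (auto simp: indicator_def)
  qed
  have ind: "integrable (P j) (indicator {w. t \<le> \<bar>w\<bar>} :: real \<Rightarrow> real)"
    by (simp add: integrable_indicator_iff M.emeasure_finite less_top[symmetric])
  have "(LINT \<xi>|\<Q>. (\<xi> j)\<^sup>2 * of_bool (t \<le> \<bar>\<xi> j\<bar>)) = (LINT w|P j. w\<^sup>2 * of_bool (t \<le> \<bar>w\<bar>))"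
    using assms(1) by (intro integral_component[of j "\<lambda>w. w\<^sup>2 * of_bool (t \<le> \<bar>w\<bar>)"]) auto
  also have "\<dots> \<le> (LINT w|P j. w ^ 4 * (exp (- u) / 2) + indicator {w. t \<le> \<bar>w\<bar>} w * (exp u / 2))"
  proof (rule integral_mono[OF _ _ pt])
    show "integrable (P j) (\<lambda>w. w\<^sup>2 * of_bool (t \<le> \<bar>w\<bar>))"
      by (rule Bochner_Integration.integrable_bound[OF integrable_square[of j]])
        (auto simp: measurable_cong_sets[OF sets_noise refl])
    show "integrable (P j) (\<lambda>w. w ^ 4 * (exp (- u) / 2) + indicator {w. t \<le> \<bar>w\<bar>} w * (exp u / 2))"
      using integrable_fourth ind by simp
  qed
  also have "\<dots> = (LINT w|P j. w ^ 4) * (exp (- u) / 2) + measure (P j) {w. t \<le> \<bar>w\<bar>} * (exp u / 2)"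
    using integrable_fourth ind by simp
  also have "\<dots> \<le> K * (exp (- u) / 2) + 2 * exp (- 2 * u) * (exp u / 2)"
    using fourth_moment_le[of j] noise[of j] assms(2)
    by (intro add_mono mult_right_mono) (auto simp: noise_class_def u_def)
  also have "\<dots> = (K / 2 + 1) * exp (- u)"
    by (simp add: algebra_simps flip: exp_add)
  finally show ?thesis by (simp add: u_def)
qed

end

section \<open>The median of means\<close>

text \<open>\<open>4 * s < m\<close> keeps the blocks that meet the support below a quarter; the
  block size \<open>128 * K\<close> is calibrated in
  \<open>tilted_product_integral_le\<close>.\<close>

locale sparse_observation = product_noise P d \<alpha> \<tau> K
  for P :: "nat \<Rightarrow> real measure" and d :: nat and \<alpha> \<tau> K :: real +
  fixes \<theta> :: "nat \<Rightarrow> real" and \<sigma> :: real and s m :: nat and B :: "nat \<Rightarrow> nat set"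
  assumes sigma_pos: "\<sigma> > 0"
    and sparse: "\<theta> \<in> sparse_vectors d s"
    and s_less: "4 * s < m"
    and blocks: "block_partition d m B"
    and block_size: "128 * K \<le> real (d div m)"
begin

definition clean :: "nat set" where
  "clean = {i \<in> {1..m}. \<forall>j\<in>B i. \<theta> j = 0}"

text \<open>The variance estimate as a function of the noise. Its mean and its lower deviations are
  bounded before any square root is taken.\<close>

definition med :: "(nat \<Rightarrow> real) \<Rightarrow> real" where
  "med \<xi> = sample_median (map (\<lambda>i. block_mean_square (B i) (observation \<sigma> \<theta> \<xi>)) [1..<Suc m])"

lemma sigma_hat_eq: "sigma_hat m B (observation \<sigma> \<theta> \<xi>) = sqrt (med \<xi>)"
  by (simp only: sigma_hat_def med_def)

lemma m_pos: "m > 0"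
  using s_less by simp

lemma indices_nonempty: "[1..<Suc m] \<noteq> []"
  using m_pos by simp

lemma block_subset: "i \<in> {1..m} \<Longrightarrow> B i \<subseteq> {1..d}"
  using blocks unfolding block_partition_def by blast

lemma finite_block: "i \<in> {1..m} \<Longrightarrow> finite (B i)"
  using block_subset finite_subset by blast

lemma block_disjoint: "i \<in> {1..m} \<Longrightarrow> i' \<in> {1..m} \<Longrightarrow> i \<noteq> i' \<Longrightarrow> B i \<inter> B i' = {}"
  using blocks unfolding block_partition_def disjoint_family_on_def by blast

lemma card_block_ge: "i \<in> {1..m} \<Longrightarrow> 128 * K \<le> real (card (B i))"
  using blocks block_size unfolding block_partition_def by (meson of_nat_le_iff order_trans)

lemma card_block_pos: "i \<in> {1..m} \<Longrightarrow> card (B i) > 0"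
  using card_block_ge[of i] K_ge_1 by (cases "card (B i)") auto

lemma clean_subset: "clean \<subseteq> {1..m}"
  by (auto simp: clean_def)

lemma finite_clean: "finite clean"
  using clean_subset finite_subset by blast

text \<open>Picking a support point in each contaminated block is injective, since the blocks are
  disjoint.\<close>

lemma card_contaminated: "card ({1..m} - clean) \<le> s"
proof -
  define f where "f i = (SOME j. j \<in> B i \<and> \<theta> j \<noteq> 0)" for i
  have f: "f i \<in> B i" "\<theta> (f i) \<noteq> 0" if "i \<in> {1..m} - clean" for i
  proof -
    from that have "\<exists>j. j \<in> B i \<and> \<theta> j \<noteq> 0" unfolding clean_def by blast
    from someI_ex[OF this] show "f i \<in> B i" "\<theta> (f i) \<noteq> 0" by (simp_all add: f_def)
  qed
  have "inj_on f ({1..m} - clean)"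
  proof (rule inj_onI)
    fix i i' assume i: "i \<in> {1..m} - clean" "i' \<in> {1..m} - clean" "f i = f i'"
    then have "f i \<in> B i \<inter> B i'" using f(1)[OF i(1)] f(1)[OF i(2)] by simp
    then show "i = i'" using i block_disjoint[of i i'] by auto
  qed
  then have "card ({1..m} - clean) \<le> card {j \<in> {1..d}. \<theta> j \<noteq> 0}"
  proof (rule card_inj_on_le)
    show "f ` ({1..m} - clean) \<subseteq> {j \<in> {1..d}. \<theta> j \<noteq> 0}" using f block_subset by blast
  qed simp
  then show ?thesis using sparse by (simp add: sparse_vectors_def)
qed

text \<open>Of at least half of the blocks, fewer than a quarter are lost to contamination. Applied
  on both sides of the median.\<close>

lemma many_clean:
  assumes "m \<le> 2 * card {i \<in> {1..m}. R i}"
  shows "m \<le> 4 * card {i \<in> clean. R i}"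
proof -
  have "card {i \<in> {1..m}. R i} \<le> card ({i \<in> clean. R i} \<union> ({1..m} - clean))"
    using finite_clean by (intro card_mono) auto
  also have "\<dots> \<le> card {i \<in> clean. R i} + card ({1..m} - clean)" by (rule card_Un_le)
  finally show ?thesis using assms card_contaminated s_less by linarith
qed

lemma block_mean_square_clean:
  assumes "i \<in> clean"
  shows "block_mean_square (B i) (observation \<sigma> \<theta> \<xi>) = \<sigma>\<^sup>2 * block_mean_square (B i) \<xi>"
  using assms by (simp add: block_mean_square_def observation_def clean_def power_mult_distrib
      sum_distrib_left)

lemma block_mean_square_nonneg: "0 \<le> block_mean_square A y"
  by (simp add: block_mean_square_def sum_nonneg)

lemma med_nonneg: "0 \<le> med \<xi>"
  unfolding med_def by (rule sample_median_nonneg) (use m_pos in \<open>auto simp: block_mean_square_nonneg\<close>)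

lemma block_mean_square_measurable:
  assumes "i \<in> {1..m}"
  shows "(\<lambda>\<xi>. block_mean_square (B i) (observation \<sigma> \<theta> \<xi>)) \<in> borel_measurable \<Q>"
proof -
  have "(\<lambda>\<xi>. \<xi> j) \<in> borel_measurable \<Q>" if "j \<in> B i" for j
    using that block_subset[OF assms] by (intro component_measurable) blast
  note [measurable] = this
  show ?thesis unfolding block_mean_square_def observation_def by measurable
qed

lemma med_measurable [measurable]: "med \<in> borel_measurable \<Q>"
  unfolding med_def
  by (rule borel_measurable_sample_median[OF block_mean_square_measurable indices_nonempty]) auto

text \<open>A quarter of the blocks are clean with mean at least \<open>med \<xi>\<close>, as in
  Markov's inequality. The bound is linear in the clean means, so expectations follow at once, and
  large entries of \<theta> do not enter it.\<close>

lemma med_le_clean_mean: "real m * med \<xi> \<le> 4 * \<sigma>\<^sup>2 * (\<Sum>i\<in>clean. block_mean_square (B i) \<xi>)"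
proof -
  define f where "f i = block_mean_square (B i) (observation \<sigma> \<theta> \<xi>)" for i
  define G where "G = {i \<in> clean. med \<xi> \<le> f i}"
  have med: "med \<xi> = sample_median (map f [1..<Suc m])"
    unfolding med_def f_def ..
  have "length (map f [1..<Suc m]) \<le> 2 * length (filter (\<lambda>x. med \<xi> \<le> x) (map f [1..<Suc m]))"
    unfolding med by (rule half_ge_sample_median) (use m_pos in simp)
  then have "m \<le> 2 * card {i \<in> {1..m}. med \<xi> \<le> f i}"
    unfolding length_filter_map_upt by (simp del: upt_Suc)
  then have "m \<le> 4 * card G" unfolding G_def by (rule many_clean)
  then have "real m * med \<xi> \<le> real (4 * card G) * med \<xi>"
    by (intro mult_right_mono med_nonneg) simp
  also have "\<dots> = 4 * (\<Sum>i\<in>G. med \<xi>)" by simp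
  also have "\<dots> \<le> 4 * (\<Sum>i\<in>clean. f i)"
    using finite_clean
    by (intro mult_left_mono order_trans[OF sum_mono[of G "\<lambda>i. med \<xi>" f] sum_mono2])
      (auto simp: G_def f_def block_mean_square_nonneg)
  also have "\<dots> = 4 * \<sigma>\<^sup>2 * (\<Sum>i\<in>clean. block_mean_square (B i) \<xi>)"
    by (simp add: f_def block_mean_square_clean sum_distrib_left mult.assoc)
  finally show ?thesis .
qed

lemma block_mean_square_noise:
  assumes "i \<in> {1..m}"
  shows "integrable \<Q> (\<lambda>\<xi>. block_mean_square (B i) \<xi>)"
    and "(LINT \<xi>|\<Q>. block_mean_square (B i) \<xi>) = 1"
proof -
  have int: "integrable \<Q> (\<lambda>\<xi>. (\<xi> j)\<^sup>2)" and one: "(LINT \<xi>|\<Q>. (\<xi> j)\<^sup>2) = 1" if "j \<in> B i" for j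
  proof -
    have j: "j \<in> {1..d}" using that block_subset[OF assms] by blast
    show "integrable \<Q> (\<lambda>\<xi>. (\<xi> j)\<^sup>2)"
      by (rule integrable_component[OF j integrable_square])
    show "(LINT \<xi>|\<Q>. (\<xi> j)\<^sup>2) = 1"
      using integral_component[OF j, of "\<lambda>w. w\<^sup>2"] second_moment by simp
  qed
  show "integrable \<Q> (\<lambda>\<xi>. block_mean_square (B i) \<xi>)"
    unfolding block_mean_square_def
    by (intro integrable_divide_zero Bochner_Integration.integrable_sum int)
  have "(LINT \<xi>|\<Q>. block_mean_square (B i) \<xi>) = (\<Sum>j\<in>B i. LINT \<xi>|\<Q>. (\<xi> j)\<^sup>2) / real (card (B i))"
    unfolding block_mean_square_def integral_divide_zero
    by (subst Bochner_Integration.integral_sum) (simp_all only: int)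
  also have "(\<Sum>j\<in>B i. LINT \<xi>|\<Q>. (\<xi> j)\<^sup>2) = (\<Sum>j\<in>B i. 1)"
    by (intro sum.cong refl one)
  also have "(\<Sum>j\<in>B i. 1) / real (card (B i)) = 1"
    using card_block_pos[OF assms] by simp
  finally show "(LINT \<xi>|\<Q>. block_mean_square (B i) \<xi>) = 1" .
qed

lemma med_integrable: "integrable \<Q> med"
  and med_integral_le: "(LINT \<xi>|\<Q>. med \<xi>) \<le> 4 * \<sigma>\<^sup>2"
proof -
  let ?b = "\<lambda>\<xi>. 4 * \<sigma>\<^sup>2 / real m * (\<Sum>i\<in>clean. block_mean_square (B i) \<xi>)"
  have le: "med \<xi> \<le> ?b \<xi>" for \<xi>
    using med_le_clean_mean[of \<xi>] m_pos by (simp add: field_simps)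
  have int: "integrable \<Q> (\<lambda>\<xi>. block_mean_square (B i) \<xi>)"
    and one: "(LINT \<xi>|\<Q>. block_mean_square (B i) \<xi>) = 1" if "i \<in> clean" for i
    using that clean_subset block_mean_square_noise[of i] by auto
  have intb: "integrable \<Q> ?b"
    by (intro integrable_mult_right Bochner_Integration.integrable_sum int)
  show med: "integrable \<Q> med"
  proof (rule Bochner_Integration.integrable_bound[OF intb med_measurable AE_I2])
    show "norm (med \<xi>) \<le> norm (?b \<xi>)" for \<xi>
      using le[of \<xi>] med_nonneg[of \<xi>] unfolding real_norm_def by linarith
  qed
  have "(LINT \<xi>|\<Q>. med \<xi>) \<le> (LINT \<xi>|\<Q>. ?b \<xi>)"
    by (intro integral_mono med intb le)
  also have "\<dots> = 4 * \<sigma>\<^sup>2 / real m * (LINT \<xi>|\<Q>. (\<Sum>i\<in>clean. block_mean_square (B i) \<xi>))"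
    by (rule integral_mult_right_zero)
  also have "(LINT \<xi>|\<Q>. (\<Sum>i\<in>clean. block_mean_square (B i) \<xi>)) = (\<Sum>i\<in>clean. LINT \<xi>|\<Q>. block_mean_square (B i) \<xi>)"
    by (rule Bochner_Integration.integral_sum[OF int])
  also have "\<dots> = (\<Sum>i\<in>clean. 1)"
    by (intro sum.cong refl one)
  also have "4 * \<sigma>\<^sup>2 / real m * (\<Sum>i\<in>clean. 1) \<le> 4 * \<sigma>\<^sup>2 / real m * real m"
    using card_mono[OF _ clean_subset] by (intro mult_left_mono) simp_all
  also have "\<dots> = 4 * \<sigma>\<^sup>2"
    using m_pos by simp
  finally show "(LINT \<xi>|\<Q>. med \<xi>) \<le> 4 * \<sigma>\<^sup>2" .
qed

text \<open>A union bound over the sets of bad clean blocks, with an exponential weight that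
  factorizes over the coordinates.\<close>

lemma med_small_le_exp_sum:
  fixes a :: real
  assumes "a > 0"
  shows "of_bool (med \<xi> < \<sigma>\<^sup>2 / 2)
    \<le> (\<Sum>I | I \<subseteq> clean \<and> m \<le> 4 * card I. \<Prod>j\<in>{1..d}. if j \<in> \<Union>(B ` I) then exp (a / 2 - a * (\<xi> j)\<^sup>2) else 1)"
    (is "_ \<le> (\<Sum>I | ?F I. ?p I)")
proof (cases "med \<xi> < \<sigma>\<^sup>2 / 2")
  case True
  \<comment> \<open>\<open>G\<close> is the member of the union that occurs: on its blocks the noise
    has mean square below 1/2.\<close>
  define G where "G = {i \<in> clean. block_mean_square (B i) (observation \<sigma> \<theta> \<xi>) \<le> med \<xi>}"
  define f where "f i = block_mean_square (B i) (observation \<sigma> \<theta> \<xi>)" for i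
  have med: "med \<xi> = sample_median (map f [1..<Suc m])"
    unfolding med_def f_def ..
  have "length (map f [1..<Suc m]) \<le> 2 * length (filter (\<lambda>x. x \<le> med \<xi>) (map f [1..<Suc m]))"
    unfolding med by (rule half_le_sample_median) (use m_pos in simp)
  then have "m \<le> 2 * card {i \<in> {1..m}. block_mean_square (B i) (observation \<sigma> \<theta> \<xi>) \<le> med \<xi>}"
    unfolding length_filter_map_upt f_def by (simp del: upt_Suc)
  then have card_G: "m \<le> 4 * card G" unfolding G_def by (rule many_clean)
  have G: "G \<subseteq> clean" "G \<subseteq> {1..m}" using clean_subset by (auto simp: G_def)
  have nonneg: "(\<Sum>j\<in>B i. a / 2 - a * (\<xi> j)\<^sup>2) \<ge> 0" if "i \<in> G" for i
  proof -
    have "\<sigma>\<^sup>2 * block_mean_square (B i) \<xi> < \<sigma>\<^sup>2 * (1 / 2)"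
      using that True by (simp add: G_def flip: block_mean_square_clean)
    then have "block_mean_square (B i) \<xi> \<le> 1 / 2"
      using sigma_pos by simp
    then have "(\<Sum>j\<in>B i. (\<xi> j)\<^sup>2) \<le> real (card (B i)) / 2"
      using card_block_pos[of i] subsetD[OF G(2) that] by (simp add: block_mean_square_def divide_le_eq)
    then have "a * (\<Sum>j\<in>B i. (\<xi> j)\<^sup>2) \<le> a * (real (card (B i)) / 2)"
      using assms by (intro mult_left_mono) auto
    then show ?thesis by (simp add: sum_subtractf sum_distrib_left mult.commute)
  qed
  have U: "\<Union>(B ` G) \<subseteq> {1..d}" using G(2) block_subset by blast
  \<comment> \<open>Every block of \<open>G\<close> contributes a nonnegative exponent, so the
    single product attached to \<open>G\<close> already dominates the indicator.\<close>
  have "1 \<le> exp (\<Sum>i\<in>G. \<Sum>j\<in>B i. a / 2 - a * (\<xi> j)\<^sup>2)"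
    by (simp add: sum_nonneg nonneg)
  also have "(\<Sum>i\<in>G. \<Sum>j\<in>B i. a / 2 - a * (\<xi> j)\<^sup>2) = (\<Sum>j\<in>\<Union>(B ` G). a / 2 - a * (\<xi> j)\<^sup>2)"
  proof (rule sum.UNION_disjoint[symmetric])
    show "finite G" by (rule finite_subset[OF G(2)]) simp
    show "\<forall>i\<in>G. finite (B i)" using G(2) finite_block by blast
    show "\<forall>i\<in>G. \<forall>i'\<in>G. i \<noteq> i' \<longrightarrow> B i \<inter> B i' = {}" using G(2) block_disjoint by blast
  qed
  also have "exp \<dots> = (\<Prod>j\<in>\<Union>(B ` G). exp (a / 2 - a * (\<xi> j)\<^sup>2))"
    by (intro exp_sum finite_subset[OF U]) simp
  also have "\<dots> = ?p G"
    using U by (intro prod.mono_neutral_cong_left) auto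
  also have "\<dots> \<le> (\<Sum>I | ?F I. ?p I)"
  proof (rule member_le_sum)
    show "0 \<le> ?p I" for I by (intro prod_nonneg ballI) simp
    show "G \<in> {I. ?F I}" using G(1) card_G by simp
    show "finite {I. ?F I}" by (rule finite_subset[of _ "Pow clean"]) (auto simp: finite_clean)
  qed
  finally show ?thesis using True by simp
next
  case False
  have "0 \<le> ?p I" for I by (intro prod_nonneg ballI) simp
  with False show ?thesis by (simp add: sum_nonneg)
qed

text \<open>By independence each coordinate in the blocks of \<open>I\<close> contributes a factor
  \<open>exp (- 1 / (16 * K))\<close>. There are at least \<open>m / 4\<close> blocks of
  \<open>128 * K\<close> points, that is \<open>32 * K * m\<close> coordinates, hence the exponent
  \<open>- 2 * m\<close>.\<close>

lemma tilted_product_integral_le: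
  assumes "I \<subseteq> {1..m}" and "m \<le> 4 * card I"
  defines "a \<equiv> 1 / (4 * K)"
  defines "f \<equiv> \<lambda>j w. if j \<in> \<Union>(B ` I) then exp (a / 2 - a * w\<^sup>2) else 1"
  shows "integrable \<Q> (\<lambda>\<xi>. \<Prod>j\<in>{1..d}. f j (\<xi> j))"
    and "(LINT \<xi>|\<Q>. (\<Prod>j\<in>{1..d}. f j (\<xi> j))) \<le> exp (- 2 * real m)"
proof -
  let ?U = "\<Union>(B ` I)"
  let ?q = "exp (- 1 / (16 * K))"
  have fint: "integrable (P j) (f j)" for j
    using tilted_integral_le(1)[of j, folded a_def]
    by (cases "j \<in> ?U") (simp_all add: f_def del: UN_iff Union_iff)
  show "integrable \<Q> (\<lambda>\<xi>. \<Prod>j\<in>{1..d}. f j (\<xi> j))"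
    by (intro product_integrable_prod fint) simp
  have U: "?U \<subseteq> {1..d}" using assms(1) block_subset by blast
  have "real (card ?U) = (\<Sum>i\<in>I. real (card (B i)))"
  proof (subst card_UN_disjoint)
    show "finite I" by (rule finite_subset[OF assms(1)]) simp
    show "\<forall>i\<in>I. finite (B i)" using assms(1) finite_block by blast
    show "\<forall>i\<in>I. \<forall>i'\<in>I. i \<noteq> i' \<longrightarrow> B i \<inter> B i' = {}" using assms(1) block_disjoint by blast
  qed simp
  also have "\<dots> \<ge> (\<Sum>i\<in>I. 128 * K)"
    using assms(1) card_block_ge by (intro sum_mono) blast
  also have "(\<Sum>i\<in>I. 128 * K) \<ge> 32 * K * real m"
  proof -
    have "real m \<le> 4 * real (card I)" using assms(2) by linarith
    then have "32 * K * real m \<le> 32 * K * (4 * real (card I))"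
      using K_ge_1 by (intro mult_left_mono) auto
    then show ?thesis by (simp add: mult_ac)
  qed
  finally have card_U: "real (card ?U) \<ge> 32 * K * real m" .
  have "(LINT \<xi>|\<Q>. (\<Prod>j\<in>{1..d}. f j (\<xi> j))) = (\<Prod>j\<in>{1..d}. LINT w|P j. f j w)"
    by (intro product_integral_prod fint) simp
  also have "\<dots> \<le> (\<Prod>j\<in>{1..d}. if j \<in> ?U then ?q else 1)"
  proof (intro prod_mono conjI)
    fix j
    show "0 \<le> (LINT w|P j. f j w)" by (intro integral_nonneg_AE) (simp add: f_def)
    show "(LINT w|P j. f j w) \<le> (if j \<in> ?U then ?q else 1)"
      using tilted_integral_le(2)[of j, folded a_def]
      by (cases "j \<in> ?U") (simp_all add: f_def del: UN_iff Union_iff)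
  qed
  also have "\<dots> = (\<Prod>j\<in>?U. ?q)"
    using U by (intro prod.mono_neutral_cong_right) auto
  also have "\<dots> = exp (- (real (card ?U) / (16 * K)))"
    by (simp flip: exp_of_nat_mult)
  also have "\<dots> \<le> exp (- 2 * real m)"
    using card_U K_ge_1 by (simp add: field_simps)
  finally show "(LINT \<xi>|\<Q>. (\<Prod>j\<in>{1..d}. f j (\<xi> j))) \<le> exp (- 2 * real m)" .
qed

lemma med_small_integrable: "integrable \<Q> (\<lambda>\<xi>. of_bool (med \<xi> < \<sigma>\<^sup>2 / 2) :: real)"
  by (rule integrable_const_bound[where B = 1]) simp_all

text \<open>The at most \<open>2 ^ m \<le> exp m\<close> sets of blocks use up half of the exponent
  \<open>- 2 * m\<close>.\<close>

lemma med_small_probability: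
  "(LINT \<xi>|\<Q>. of_bool (med \<xi> < \<sigma>\<^sup>2 / 2)) \<le> exp (- real m)"
proof -
  define a where "a = 1 / (4 * K)"
  let ?p = "\<lambda>I \<xi>. \<Prod>j\<in>{1..d}. if j \<in> \<Union>(B ` I) then exp (a / 2 - a * (\<xi> j)\<^sup>2) else 1"
  let ?F = "{I. I \<subseteq> clean \<and> m \<le> 4 * card I}"
  have a: "a > 0" using K_ge_1 by (simp add: a_def)
  have p: "integrable \<Q> (?p I)" "(LINT \<xi>|\<Q>. ?p I \<xi>) \<le> exp (- 2 * real m)" if "I \<in> ?F" for I
  proof -
    have I: "I \<subseteq> {1..m}" "m \<le> 4 * card I" using that clean_subset by auto
    show "integrable \<Q> (?p I)" "(LINT \<xi>|\<Q>. ?p I \<xi>) \<le> exp (- 2 * real m)"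
      by (rule tilted_product_integral_le[OF I, folded a_def])+
  qed
  have "(LINT \<xi>|\<Q>. of_bool (med \<xi> < \<sigma>\<^sup>2 / 2)) \<le> (LINT \<xi>|\<Q>. (\<Sum>I\<in>?F. ?p I \<xi>))"
    by (intro integral_mono med_small_integrable med_small_le_exp_sum a Bochner_Integration.integrable_sum p)
  also have "\<dots> = (\<Sum>I\<in>?F. LINT \<xi>|\<Q>. ?p I \<xi>)"
    by (intro Bochner_Integration.integral_sum p)
  also have "\<dots> \<le> (\<Sum>I\<in>?F. exp (- 2 * real m))"
    by (intro sum_mono p)
  also have "\<dots> = real (card ?F) * exp (- 2 * real m)" by simp
  also have "\<dots> \<le> exp (real m) * exp (- 2 * real m)"
  proof (intro mult_right_mono)
    have "card ?F \<le> card (Pow {1..m})"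
      using clean_subset by (intro card_mono) auto
    then have "card ?F \<le> 2 ^ m" by (simp only: card_Pow finite_atLeastAtMost card_atLeastAtMost) simp
    then have "real (card ?F) \<le> real (2 ^ m)" by (rule of_nat_mono)
    also have "\<dots> = 2 ^ m" by simp
    also have "\<dots> \<le> exp 1 ^ m"
      using exp_ge_add_one_self[of 1] by (intro power_mono) auto
    also have "\<dots> = exp (real m)" by (simp flip: exp_of_nat_mult)
    finally show "real (card ?F) \<le> exp (real m)" .
  qed simp
  also have "\<dots> = exp (- real m)" by (simp flip: exp_add)
  finally show ?thesis .
qed

text \<open>The coordinate and the bad event are dependent, so the fourth moment is traded against
  the probability of the event, as in the Cauchy-Schwarz inequality; half of the exponent
  survives.\<close>

lemma second_moment_med_small_le:
  assumes "j \<in> {1..d}"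
  shows "integrable \<Q> (\<lambda>\<xi>. (\<xi> j)\<^sup>2 * of_bool (med \<xi> < \<sigma>\<^sup>2 / 2))"
    and "(LINT \<xi>|\<Q>. (\<xi> j)\<^sup>2 * of_bool (med \<xi> < \<sigma>\<^sup>2 / 2)) \<le> (K + 1) / 2 * exp (- real m / 2)"
proof -
  define u where "u = real m"
  let ?b = "\<lambda>\<xi>. of_bool (med \<xi> < \<sigma>\<^sup>2 / 2) :: real"
  \<comment> \<open>The weights balance: the event gets the factor \<open>exp (u / 2)\<close>, which
    its probability \<open>exp (- u)\<close> turns into the \<open>exp (- u / 2)\<close> of the
    fourth moment term.\<close>
  have pt: "w\<^sup>2 * of_bool R \<le> w ^ 4 * (exp (- u / 2) / 2) + of_bool R * (exp (u / 2) / 2)" for w R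
  proof -
    have "2 * (w\<^sup>2 * exp (- u / 4)) * exp (u / 4) \<le> (w\<^sup>2 * exp (- u / 4))\<^sup>2 + (exp (u / 4))\<^sup>2"
      by (rule sum_squares_bound)
    also have "2 * (w\<^sup>2 * exp (- u / 4)) * exp (u / 4) = 2 * w\<^sup>2"
      by (simp add: exp_minus)
    also have "(w\<^sup>2 * exp (- u / 4))\<^sup>2 = w ^ 4 * exp (- u / 2)"
      by (simp add: power_mult_distrib flip: power_mult exp_of_nat_mult)
    also have "(exp (u / 4))\<^sup>2 = exp (u / 2)"
      by (simp flip: exp_of_nat_mult)
    finally show ?thesis by (cases R) auto
  qed
  note [measurable] = component_measurable[OF assms]
  have i2: "integrable \<Q> (\<lambda>\<xi>. (\<xi> j)\<^sup>2)" and i4: "integrable \<Q> (\<lambda>\<xi>. (\<xi> j) ^ 4)"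
    using integrable_component[OF assms integrable_square] integrable_component[OF assms integrable_fourth] .
  show int: "integrable \<Q> (\<lambda>\<xi>. (\<xi> j)\<^sup>2 * ?b \<xi>)"
    by (rule Bochner_Integration.integrable_bound[OF i2]) (use assms in auto)
  have "(LINT \<xi>|\<Q>. (\<xi> j)\<^sup>2 * ?b \<xi>) \<le> (LINT \<xi>|\<Q>. (\<xi> j) ^ 4 * (exp (- u / 2) / 2) + ?b \<xi> * (exp (u / 2) / 2))"
    using i4 med_small_integrable by (intro integral_mono int pt) simp
  also have "\<dots> = (LINT \<xi>|\<Q>. (\<xi> j) ^ 4) * (exp (- u / 2) / 2) + (LINT \<xi>|\<Q>. ?b \<xi>) * (exp (u / 2) / 2)"
    using i4 med_small_integrable by simp
  also have "\<dots> \<le> K * (exp (- u / 2) / 2) + exp (- u) * (exp (u / 2) / 2)"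
    using fourth_moment_le[of j] integral_component[OF assms, of "\<lambda>w. w ^ 4"] med_small_probability
    by (intro add_mono mult_right_mono) (auto simp: u_def)
  also have "\<dots> = (K + 1) / 2 * exp (- u / 2)"
    by (simp add: algebra_simps flip: exp_add)
  finally show "(LINT \<xi>|\<Q>. (\<xi> j)\<^sup>2 * ?b \<xi>) \<le> (K + 1) / 2 * exp (- real m / 2)"
    by (simp add: u_def)
qed

text \<open>Off the support an observation is pure noise and enters the block means only through its
  square.\<close>

lemma med_flip:
  assumes "\<theta> j = 0"
  shows "med (\<xi>(j := - \<xi> j)) = med \<xi>"
proof -
  have "(observation \<sigma> \<theta> (\<xi>(j := - \<xi> j)) k)\<^sup>2 = (observation \<sigma> \<theta> \<xi> k)\<^sup>2" for k
    using assms by (simp add: observation_def)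
  then show ?thesis by (simp add: med_def block_mean_square_def)
qed

end

section \<open>The three parts of the risk\<close>

context sparse_observation
begin

text \<open>For \<open>lam \<le> \<bar>\<eta> j\<bar>\<close> the exponential weight is at least
  \<open>exp (- 1)\<close>, so keeping such a coordinate uncut costs only a factor
  \<open>exp 1\<close>.\<close>

lemma linear_part_risk:
  fixes \<eta> :: "nat \<Rightarrow> real"
  assumes "\<alpha> > 0" "lam \<ge> 0" and c: "c \<le> d"
    and nz: "\<And>j. j \<in> {1..d} \<Longrightarrow> \<eta> j \<noteq> 0"
    and big: "\<And>j. j \<in> {1..c} \<Longrightarrow> lam \<le> \<bar>\<eta> j\<bar>"
  shows "integrable \<Q> (\<lambda>\<xi>. (\<Sum>j\<in>{1..c}. \<eta> j * (\<sigma> * \<xi> j))\<^sup>2)" (is ?int)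
    and "(LINT \<xi>|\<Q>. (\<Sum>j\<in>{1..c}. \<eta> j * (\<sigma> * \<xi> j))\<^sup>2)
      \<le> \<sigma>\<^sup>2 * (exp 1 * (\<Sum>j=1..d. (\<eta> j)\<^sup>2 * exp (- ((lam / \<bar>\<eta> j\<bar>) powr \<alpha>))))" (is ?le)
proof -
  let ?v = "\<lambda>j. (\<eta> j)\<^sup>2 * exp (- ((lam / \<bar>\<eta> j\<bar>) powr \<alpha>))"
  let ?g = "\<lambda>j \<xi>. \<eta> j * (\<sigma> * \<xi> j)"
  have sub: "{1..c} \<subseteq> {1..d}" using c by auto
  have sq: "integrable \<Q> (\<lambda>\<xi>. (?g j \<xi>)\<^sup>2)" "(LINT \<xi>|\<Q>. (?g j \<xi>)\<^sup>2) = \<sigma>\<^sup>2 * (\<eta> j)\<^sup>2"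
    if "j \<in> {1..d}" for j
    using integrable_component[OF that integrable_square] integral_component[OF that, of "\<lambda>w. w\<^sup>2"]
    by (simp_all add: power_mult_distrib second_moment)
  have meas: "?g j \<in> borel_measurable \<Q>" if "j \<in> {1..d}" for j
    using component_measurable[OF that] by measurable
  have *: ?int "(LINT \<xi>|\<Q>. (\<Sum>j\<in>{1..c}. ?g j \<xi>)\<^sup>2) = (\<Sum>j\<in>{1..c}. LINT \<xi>|\<Q>. (?g j \<xi>)\<^sup>2)"
    by (rule integral_square_sum_odd[OF sub, of ?g]; (rule meas sq(1))?; use sub in force)+
  show ?int by (rule *(1))
  have "(\<Sum>j\<in>{1..c}. LINT \<xi>|\<Q>. (?g j \<xi>)\<^sup>2) = (\<Sum>j\<in>{1..c}. \<sigma>\<^sup>2 * (\<eta> j)\<^sup>2)"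
    using sub by (intro sum.cong sq(2)) auto
  also have "\<dots> \<le> (\<Sum>j\<in>{1..c}. \<sigma>\<^sup>2 * (exp 1 * ?v j))"
  proof (intro sum_mono mult_left_mono)
    fix j assume j: "j \<in> {1..c}"
    have "(lam / \<bar>\<eta> j\<bar>) powr \<alpha> \<le> 1"
      using assms big[OF j] nz[of j] j by (intro powr_le1) auto
    then have "1 \<le> exp (1 - (lam / \<bar>\<eta> j\<bar>) powr \<alpha>)" by simp
    then have "(\<eta> j)\<^sup>2 * 1 \<le> (\<eta> j)\<^sup>2 * exp (1 - (lam / \<bar>\<eta> j\<bar>) powr \<alpha>)"
      by (intro mult_left_mono) auto
    also have "\<dots> = exp 1 * ?v j" by (simp add: exp_diff exp_minus field_simps)
    finally show "(\<eta> j)\<^sup>2 \<le> exp 1 * ?v j" by simp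
  qed simp
  also have "\<dots> \<le> (\<Sum>j=1..d. \<sigma>\<^sup>2 * (exp 1 * ?v j))"
    using sub by (intro sum_mono2) auto
  finally show ?le unfolding *(2) by (simp add: sum_distrib_left)
qed

definition threshold :: "real \<Rightarrow> (nat \<Rightarrow> real) \<Rightarrow> real" where
  "threshold lam \<xi> = sqrt 2 * sqrt (med \<xi>) * \<tau> * lam"

lemma threshold_measurable [measurable]: "threshold lam \<in> borel_measurable \<Q>"
  unfolding threshold_def by measurable

text \<open>On the good event the random threshold is at least the deterministic one,
  \<open>\<sigma> * \<tau> * lam\<close>, and the tail bound gives the weights. On the bad event
  thresholding is ignored and the small probability pays.\<close>

lemma thresholded_noise_risk:
  fixes \<eta> :: "nat \<Rightarrow> real" and lam :: real and c :: nat
  assumes "\<tau> > 0" "lam \<ge> 0"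
    and nz: "\<And>j. j \<in> {1..d} \<Longrightarrow> \<eta> j \<noteq> 0"
    and small: "\<And>j. j \<in> {c<..d} \<Longrightarrow> \<bar>\<eta> j\<bar> < lam"
  defines "J \<equiv> {j \<in> {c<..d}. \<theta> j = 0}"
  defines "g \<equiv> \<lambda>j \<xi>. \<eta> j * (\<sigma> * \<xi> j) * of_bool (threshold lam \<xi> < \<bar>\<eta> j * (\<sigma> * \<xi> j)\<bar>)"
  shows "integrable \<Q> (\<lambda>\<xi>. (\<Sum>j\<in>J. g j \<xi>)\<^sup>2)" (is ?int)
    and "(LINT \<xi>|\<Q>. (\<Sum>j\<in>J. g j \<xi>)\<^sup>2)
      \<le> \<sigma>\<^sup>2 * ((K / 2 + 1) * (\<Sum>j=1..d. (\<eta> j)\<^sup>2 * exp (- ((lam / \<bar>\<eta> j\<bar>) powr \<alpha>)))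
        + (K + 1) / 2 * lam\<^sup>2 * (real d * exp (- real m / 2)))" (is ?le)
proof -
  let ?v = "\<lambda>j. (\<eta> j)\<^sup>2 * exp (- ((lam / \<bar>\<eta> j\<bar>) powr \<alpha>))"
  let ?small = "\<lambda>\<xi>. of_bool (med \<xi> < \<sigma>\<^sup>2 / 2) :: real"
  let ?r = "(K + 1) / 2 * exp (- real m / 2)"
  have J: "J \<subseteq> {1..d}" by (auto simp: J_def)
  have comp: "(\<lambda>\<xi>. \<xi> j) \<in> borel_measurable \<Q>" if "j \<in> J" for j
    using that J by (intro component_measurable) blast
  have meas: "g j \<in> borel_measurable \<Q>" if "j \<in> J" for j
    using comp[OF that] unfolding g_def by measurable
  have i2: "integrable \<Q> (\<lambda>\<xi>. (\<xi> j)\<^sup>2)" if "j \<in> J" for j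
    using that J by (intro integrable_component integrable_square) blast
  have sq: "integrable \<Q> (\<lambda>\<xi>. (g j \<xi>)\<^sup>2)" if "j \<in> J" for j
  proof (rule Bochner_Integration.integrable_bound)
    show "integrable \<Q> (\<lambda>\<xi>. (\<eta> j)\<^sup>2 * \<sigma>\<^sup>2 * (\<xi> j)\<^sup>2)" using i2[OF that] by simp
    show "(\<lambda>\<xi>. (g j \<xi>)\<^sup>2) \<in> borel_measurable \<Q>" using meas[OF that] by measurable
  qed (simp add: g_def power_mult_distrib mult.assoc)
  \<comment> \<open>Oddness in the own coordinate and evenness in the others both rest on
    \<open>med_flip\<close>, hence the restriction of \<open>J\<close> to zeros of \<theta>.\<close>
  have *: ?int "(LINT \<xi>|\<Q>. (\<Sum>j\<in>J. g j \<xi>)\<^sup>2) = (\<Sum>j\<in>J. LINT \<xi>|\<Q>. (g j \<xi>)\<^sup>2)"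
    by (rule integral_square_sum_odd[OF J, of g]; (rule meas sq)?;
        auto simp: g_def threshold_def med_flip J_def)+
  show ?int by (rule *(1))
  have bound: "(LINT \<xi>|\<Q>. (g j \<xi>)\<^sup>2) \<le> \<sigma>\<^sup>2 * ((K / 2 + 1) * ?v j + lam\<^sup>2 * ?r)" if "j \<in> J" for j
  proof -
    define t where "t = \<tau> * lam / \<bar>\<eta> j\<bar>"
    have j: "j \<in> {1..d}" and eta: "\<eta> j \<noteq> 0" using that J nz by blast+
    have t: "t \<ge> 0" "t / \<tau> = lam / \<bar>\<eta> j\<bar>" using assms(1,2) by (simp_all add: t_def)
    note [measurable] = comp[OF that]
    have itail: "integrable \<Q> (\<lambda>\<xi>. (\<xi> j)\<^sup>2 * of_bool (t \<le> \<bar>\<xi> j\<bar>))"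
      by (rule Bochner_Integration.integrable_bound[OF i2[OF that]]) auto
    have pt: "(g j \<xi>)\<^sup>2 \<le> (\<eta> j)\<^sup>2 * \<sigma>\<^sup>2 * ((\<xi> j)\<^sup>2 * of_bool (t \<le> \<bar>\<xi> j\<bar>) + (\<xi> j)\<^sup>2 * ?small \<xi>)" for \<xi>
    proof (cases "med \<xi> < \<sigma>\<^sup>2 / 2")
      case True
      then show ?thesis by (simp add: g_def power_mult_distrib mult.assoc)
    next
      case False
      \<comment> \<open>Here \<open>sqrt 2 * sqrt (med \<xi>)\<close> is at least \<sigma>, so
        passing the random threshold implies passing the deterministic one.\<close>
      have "t \<le> \<bar>\<xi> j\<bar>" if "threshold lam \<xi> < \<bar>\<eta> j * (\<sigma> * \<xi> j)\<bar>"
      proof -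
        have "\<sigma> = sqrt (\<sigma>\<^sup>2)" using sigma_pos by simp
        also have "\<dots> \<le> sqrt 2 * sqrt (med \<xi>)"
          using False by (subst real_sqrt_mult[symmetric], intro real_sqrt_le_mono) simp
        finally have "\<sigma> * (\<tau> * lam) \<le> sqrt 2 * sqrt (med \<xi>) * (\<tau> * lam)"
          using assms(1,2) by (intro mult_right_mono) auto
        also have "\<dots> \<le> \<bar>\<eta> j * (\<sigma> * \<xi> j)\<bar>"
          using that by (simp add: threshold_def mult.assoc)
        also have "\<dots> = \<sigma> * (\<bar>\<eta> j\<bar> * \<bar>\<xi> j\<bar>)"
          using sigma_pos by (simp add: abs_mult)
        finally show ?thesis using sigma_pos eta by (simp add: t_def divide_le_eq mult.commute)
      qed
      then show ?thesis by (auto simp: g_def power_mult_distrib)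
    qed
    have "(LINT \<xi>|\<Q>. (g j \<xi>)\<^sup>2)
        \<le> (LINT \<xi>|\<Q>. (\<eta> j)\<^sup>2 * \<sigma>\<^sup>2 * ((\<xi> j)\<^sup>2 * of_bool (t \<le> \<bar>\<xi> j\<bar>) + (\<xi> j)\<^sup>2 * ?small \<xi>))"
      by (intro integral_mono sq[OF that] pt integrable_mult_right Bochner_Integration.integrable_add
          itail second_moment_med_small_le(1)[OF j])
    also have "\<dots> = (\<eta> j)\<^sup>2 * \<sigma>\<^sup>2 * ((LINT \<xi>|\<Q>. (\<xi> j)\<^sup>2 * of_bool (t \<le> \<bar>\<xi> j\<bar>)) + (LINT \<xi>|\<Q>. (\<xi> j)\<^sup>2 * ?small \<xi>))"
      using itail second_moment_med_small_le(1)[OF j]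
      by (subst integral_mult_right_zero, subst Bochner_Integration.integral_add) simp_all
    also have "\<dots> \<le> (\<eta> j)\<^sup>2 * \<sigma>\<^sup>2 * ((K / 2 + 1) * exp (- ((lam / \<bar>\<eta> j\<bar>) powr \<alpha>)) + ?r)"
      using tail_second_moment_le[OF j t(1)] second_moment_med_small_le(2)[OF j] t(2)
      by (intro mult_left_mono add_mono) auto
    also have "\<dots> = \<sigma>\<^sup>2 * ((K / 2 + 1) * ?v j + (\<eta> j)\<^sup>2 * ?r)"
      by (simp add: algebra_simps)
    also have "\<dots> \<le> \<sigma>\<^sup>2 * ((K / 2 + 1) * ?v j + lam\<^sup>2 * ?r)"
    proof -
      \<comment> \<open>Beyond the cutoff the coefficients are below \<open>lam\<close>, which makes
        the bad-event cost comparable with \<open>rate_Phi\<close>.\<close>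
      have "(\<eta> j)\<^sup>2 \<le> lam\<^sup>2"
        using small[of j] that assms(2) by (intro abs_le_square_iff[THEN iffD1]) (auto simp: J_def)
      then show ?thesis
        using K_ge_1 by (intro mult_left_mono add_left_mono mult_right_mono) auto
    qed
    finally show ?thesis .
  qed
  have "(\<Sum>j\<in>J. LINT \<xi>|\<Q>. (g j \<xi>)\<^sup>2) \<le> (\<Sum>j\<in>J. \<sigma>\<^sup>2 * ((K / 2 + 1) * ?v j + lam\<^sup>2 * ?r))"
    by (intro sum_mono bound)
  also have "\<dots> \<le> (\<Sum>j=1..d. \<sigma>\<^sup>2 * ((K / 2 + 1) * ?v j + lam\<^sup>2 * ?r))"
    using J K_ge_1 by (intro sum_mono2) auto
  also have "\<dots> = \<sigma>\<^sup>2 * ((K / 2 + 1) * (\<Sum>j=1..d. ?v j) + (K + 1) / 2 * lam\<^sup>2 * (real d * exp (- real m / 2)))"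
    by (simp add: sum.distrib flip: sum_distrib_left)
  finally show ?le unfolding *(2) .
qed

text \<open>Cauchy-Schwarz over at most \<open>s\<close> terms, each of mean order
  \<open>lam\<^sup>2 * \<sigma>\<^sup>2\<close>, yields the square of \<open>lam * s\<close>. A
  pointwise majorant \<open>U\<close> suffices, since the risk is a nonnegative integral.\<close>

lemma support_part_risk:
  fixes \<eta> :: "nat \<Rightarrow> real" and lam :: real and c :: nat
  assumes "\<tau> > 0" "lam \<ge> 0"
    and small: "\<And>j. j \<in> {c<..d} \<Longrightarrow> \<bar>\<eta> j\<bar> < lam"
  defines "R \<equiv> {j \<in> {c<..d}. \<theta> j \<noteq> 0}"
  defines "h \<equiv> \<lambda>j \<xi>. \<eta> j * (\<theta> j + \<sigma> * \<xi> j) * of_bool (threshold lam \<xi> < \<bar>\<eta> j * (\<theta> j + \<sigma> * \<xi> j)\<bar>) - \<eta> j * \<theta> j"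
  defines "U \<equiv> \<lambda>\<xi>. real s * (\<Sum>j\<in>R. 4 * \<tau>\<^sup>2 * lam\<^sup>2 * med \<xi> + 2 * lam\<^sup>2 * \<sigma>\<^sup>2 * (\<xi> j)\<^sup>2)"
  shows "(\<Sum>j\<in>R. h j \<xi>)\<^sup>2 \<le> U \<xi>"
    and "integrable \<Q> U"
    and "(LINT \<xi>|\<Q>. U \<xi>) \<le> \<sigma>\<^sup>2 * ((16 * \<tau>\<^sup>2 + 2) * (lam * real s)\<^sup>2)"
proof -
  have R: "R \<subseteq> {1..d}" by (auto simp: R_def)
  have "card R \<le> card {j \<in> {1..d}. \<theta> j \<noteq> 0}" by (intro card_mono) (auto simp: R_def)
  also have "\<dots> \<le> s" using sparse by (simp add: sparse_vectors_def)
  finally have card_R: "card R \<le> s" .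
  have T2: "(threshold lam \<xi>)\<^sup>2 = 2 * \<tau>\<^sup>2 * lam\<^sup>2 * med \<xi>" for \<xi>
    using med_nonneg[of \<xi>] by (simp add: threshold_def power_mult_distrib)
  have T: "threshold lam \<xi> \<ge> 0" for \<xi>
    using med_nonneg[of \<xi>] assms(1,2) by (simp add: threshold_def)
  have term_le: "(h j \<xi>)\<^sup>2 \<le> 4 * \<tau>\<^sup>2 * lam\<^sup>2 * med \<xi> + 2 * lam\<^sup>2 * \<sigma>\<^sup>2 * (\<xi> j)\<^sup>2" if "j \<in> R" for j \<xi>
  proof -
    let ?y = "\<eta> j * (\<theta> j + \<sigma> * \<xi> j)"
    \<comment> \<open>An observation that is cut does not exceed the threshold in absolute value, so
      the error is bounded uniformly in \<open>\<theta> j\<close>.\<close>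
    have "h j \<xi> = \<eta> j * (\<sigma> * \<xi> j) - ?y * of_bool (\<bar>?y\<bar> \<le> threshold lam \<xi>)"
      by (simp add: h_def algebra_simps)
    moreover have "\<bar>?y * of_bool (\<bar>?y\<bar> \<le> threshold lam \<xi>)\<bar> \<le> threshold lam \<xi>"
      using T[of \<xi>] by simp
    moreover have "\<bar>\<eta> j * (\<sigma> * \<xi> j)\<bar> \<le> lam * \<sigma> * \<bar>\<xi> j\<bar>"
      using small[of j] that sigma_pos by (simp add: R_def abs_mult mult_right_mono)
    ultimately have "\<bar>h j \<xi>\<bar> \<le> threshold lam \<xi> + lam * \<sigma> * \<bar>\<xi> j\<bar>" by linarith
    then have "(h j \<xi>)\<^sup>2 \<le> (threshold lam \<xi> + lam * \<sigma> * \<bar>\<xi> j\<bar>)\<^sup>2"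
      by (metis abs_ge_zero power2_abs power_mono)
    also have "\<dots> \<le> 2 * (threshold lam \<xi>)\<^sup>2 + 2 * (lam * \<sigma> * \<bar>\<xi> j\<bar>)\<^sup>2"
      using sum_squares_bound[of "threshold lam \<xi>" "lam * \<sigma> * \<bar>\<xi> j\<bar>"] by (simp add: power2_sum)
    finally show ?thesis by (simp add: T2 power_mult_distrib mult.assoc)
  qed
  have "(\<Sum>j\<in>R. h j \<xi>)\<^sup>2 \<le> (\<Sum>j\<in>R. (h j \<xi>)\<^sup>2) * real (card R)"
    by (rule sum_squared_le_sum_of_squares)
  also have "\<dots> \<le> (\<Sum>j\<in>R. 4 * \<tau>\<^sup>2 * lam\<^sup>2 * med \<xi> + 2 * lam\<^sup>2 * \<sigma>\<^sup>2 * (\<xi> j)\<^sup>2) * real s"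
    using card_R by (intro mult_mono sum_mono term_le sum_nonneg) (auto simp: med_nonneg)
  finally show "(\<Sum>j\<in>R. h j \<xi>)\<^sup>2 \<le> U \<xi>" by (simp add: U_def mult.commute)
  have i2: "integrable \<Q> (\<lambda>\<xi>. (\<xi> j)\<^sup>2)" "(LINT \<xi>|\<Q>. (\<xi> j)\<^sup>2) = 1" if "j \<in> R" for j
  proof -
    have j: "j \<in> {1..d}" using that R by blast
    show "integrable \<Q> (\<lambda>\<xi>. (\<xi> j)\<^sup>2)" by (rule integrable_component[OF j integrable_square])
    show "(LINT \<xi>|\<Q>. (\<xi> j)\<^sup>2) = 1"
      using integral_component[OF j, of "\<lambda>w. w\<^sup>2"] second_moment by simp
  qed
  show "integrable \<Q> U"
    unfolding U_def using med_integrable i2(1) by auto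
  have "(LINT \<xi>|\<Q>. U \<xi>) = real s * (\<Sum>j\<in>R. 4 * \<tau>\<^sup>2 * lam\<^sup>2 * (LINT \<xi>|\<Q>. med \<xi>) + 2 * lam\<^sup>2 * \<sigma>\<^sup>2 * 1)"
    unfolding U_def using med_integrable i2 by simp
  also have "\<dots> \<le> real s * (\<Sum>j\<in>R. 4 * \<tau>\<^sup>2 * lam\<^sup>2 * (4 * \<sigma>\<^sup>2) + 2 * lam\<^sup>2 * \<sigma>\<^sup>2 * 1)"
    by (intro mult_left_mono sum_mono add_mono med_integral_le order_refl) auto
  also have "\<dots> = real s * (real (card R) * (\<sigma>\<^sup>2 * (16 * \<tau>\<^sup>2 + 2) * lam\<^sup>2))"
    by (simp add: algebra_simps)
  also have "\<dots> \<le> real s * (real s * (\<sigma>\<^sup>2 * (16 * \<tau>\<^sup>2 + 2) * lam\<^sup>2))"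
    using card_R by (intro mult_left_mono mult_right_mono) auto
  also have "\<dots> = \<sigma>\<^sup>2 * ((16 * \<tau>\<^sup>2 + 2) * (lam * real s)\<^sup>2)"
    by (simp add: power2_eq_square algebra_simps)
  finally show "(LINT \<xi>|\<Q>. U \<xi>) \<le> \<sigma>\<^sup>2 * ((16 * \<tau>\<^sup>2 + 2) * (lam * real s)\<^sup>2)" .
qed

text \<open>The factor 3 comes from squaring a sum of three parts; the last summand is the price of
  the event that the median is too small.\<close>

lemma risk_le:
  fixes \<eta> :: "nat \<Rightarrow> real" and lam :: real and c :: nat
  assumes "\<alpha> > 0" "\<tau> > 0" "lam \<ge> 0" and c: "c \<le> d"
    and nz: "\<And>j. j \<in> {1..d} \<Longrightarrow> \<eta> j \<noteq> 0"
    and big: "\<And>j. j \<in> {1..c} \<Longrightarrow> lam \<le> \<bar>\<eta> j\<bar>"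
    and small: "\<And>j. j \<in> {c<..d} \<Longrightarrow> \<bar>\<eta> j\<bar> < lam"
  defines "y \<equiv> observation \<sigma> \<theta>"
  defines "V \<equiv> (\<Sum>j=1..d. (\<eta> j)\<^sup>2 * exp (- ((lam / \<bar>\<eta> j\<bar>) powr \<alpha>)))"
  shows "(\<integral>\<^sup>+\<xi>. ennreal (((\<Sum>j\<in>{1..c}. \<eta> j * y \<xi> j)
        + (\<Sum>j\<in>{c<..d}. \<eta> j * y \<xi> j * of_bool (\<bar>\<eta> j * y \<xi> j\<bar> > threshold lam \<xi>))
        - linear_functional \<eta> d \<theta>)\<^sup>2) \<partial>\<Q>)
    \<le> ennreal (3 * \<sigma>\<^sup>2 * ((exp 1 + K / 2 + 1) * V + (16 * \<tau>\<^sup>2 + 2) * (lam * real s)\<^sup>2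
        + (K + 1) / 2 * lam\<^sup>2 * (real d * exp (- real m / 2))))"
    (is "(\<integral>\<^sup>+\<xi>. ennreal ((?err \<xi>)\<^sup>2) \<partial>\<Q>) \<le> ennreal ?rhs")
proof -
  define J where "J = {j \<in> {c<..d}. \<theta> j = 0}"
  define R where "R = {j \<in> {c<..d}. \<theta> j \<noteq> 0}"
  define f where "f j \<xi> = \<eta> j * y \<xi> j * of_bool (\<bar>\<eta> j * y \<xi> j\<bar> > threshold lam \<xi>) - \<eta> j * \<theta> j" for j \<xi>
  define X1 where "X1 \<xi> = (\<Sum>j\<in>{1..c}. \<eta> j * (\<sigma> * \<xi> j))" for \<xi>
  define X3 where "X3 \<xi> = (\<Sum>j\<in>J. \<eta> j * (\<sigma> * \<xi> j) * of_bool (threshold lam \<xi> < \<bar>\<eta> j * (\<sigma> * \<xi> j)\<bar>))" for \<xi>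
  define U where "U \<xi> = real s * (\<Sum>j\<in>R. 4 * \<tau>\<^sup>2 * lam\<^sup>2 * med \<xi> + 2 * lam\<^sup>2 * \<sigma>\<^sup>2 * (\<xi> j)\<^sup>2)" for \<xi>
  have x1: "integrable \<Q> (\<lambda>\<xi>. (X1 \<xi>)\<^sup>2)"
    unfolding X1_def by (rule linear_part_risk(1)[where \<eta> = \<eta>]; fact)
  have x1_le: "(LINT \<xi>|\<Q>. (X1 \<xi>)\<^sup>2) \<le> \<sigma>\<^sup>2 * (exp 1 * V)"
    unfolding X1_def V_def by (rule linear_part_risk(2)[where \<eta> = \<eta>]; fact)
  have U: "(\<Sum>j\<in>R. f j \<xi>)\<^sup>2 \<le> U \<xi>" for \<xi>
    unfolding U_def R_def f_def y_def observation_def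
    by (rule support_part_risk(1)[where \<eta> = \<eta>]; fact)
  have xU: "integrable \<Q> U"
    unfolding U_def R_def by (rule support_part_risk(2)[where \<eta> = \<eta>]; fact)
  have xU_le: "(LINT \<xi>|\<Q>. U \<xi>) \<le> \<sigma>\<^sup>2 * ((16 * \<tau>\<^sup>2 + 2) * (lam * real s)\<^sup>2)"
    unfolding U_def R_def by (rule support_part_risk(3)[where \<eta> = \<eta>]; fact)
  have x3: "integrable \<Q> (\<lambda>\<xi>. (X3 \<xi>)\<^sup>2)"
    unfolding X3_def J_def by (rule thresholded_noise_risk(1)[where \<eta> = \<eta>]; fact)
  have x3_le: "(LINT \<xi>|\<Q>. (X3 \<xi>)\<^sup>2)
      \<le> \<sigma>\<^sup>2 * ((K / 2 + 1) * V + (K + 1) / 2 * lam\<^sup>2 * (real d * exp (- real m / 2)))"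
    unfolding X3_def J_def V_def by (rule thresholded_noise_risk(2)[where \<eta> = \<eta>]; fact)
  have split: "{1..d} = {1..c} \<union> {c<..d}" "{c<..d} = J \<union> R"
    using c by (auto simp: J_def R_def)
  have err: "?err \<xi> = X1 \<xi> + (\<Sum>j\<in>R. f j \<xi>) + X3 \<xi>" for \<xi>
  proof -
    have "linear_functional \<eta> d \<theta> = (\<Sum>j\<in>{1..c}. \<eta> j * \<theta> j) + (\<Sum>j\<in>{c<..d}. \<eta> j * \<theta> j)"
      unfolding linear_functional_def split(1) by (rule sum.union_disjoint) auto
    then have "?err \<xi> = (\<Sum>j\<in>{1..c}. \<eta> j * y \<xi> j - \<eta> j * \<theta> j) + (\<Sum>j\<in>{c<..d}. f j \<xi>)"
      by (simp add: sum_subtractf f_def)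
    also have "(\<Sum>j\<in>{1..c}. \<eta> j * y \<xi> j - \<eta> j * \<theta> j) = X1 \<xi>"
      by (simp add: X1_def y_def observation_def algebra_simps)
    also have "(\<Sum>j\<in>{c<..d}. f j \<xi>) = (\<Sum>j\<in>J. f j \<xi>) + (\<Sum>j\<in>R. f j \<xi>)"
      unfolding split(2) by (rule sum.union_disjoint) (auto simp: J_def R_def)
    also have "(\<Sum>j\<in>J. f j \<xi>) = X3 \<xi>"
      unfolding X3_def by (intro sum.cong) (auto simp: f_def y_def observation_def J_def)
    finally show ?thesis by simp
  qed
  have three: "(a + b + e)\<^sup>2 \<le> 3 * (a\<^sup>2 + u + e\<^sup>2)" if "b\<^sup>2 \<le> u" for a b e u :: real
  proof -
    have "(a + b + e)\<^sup>2 \<le> 3 * (a\<^sup>2 + b\<^sup>2 + e\<^sup>2)"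
      using sum_squares_bound[of a b] sum_squares_bound[of a e] sum_squares_bound[of b e]
      by (simp add: power2_eq_square algebra_simps)
    also have "\<dots> \<le> 3 * (a\<^sup>2 + u + e\<^sup>2)" using that by simp
    finally show ?thesis .
  qed
  have int: "integrable \<Q> (\<lambda>\<xi>. 3 * ((X1 \<xi>)\<^sup>2 + U \<xi> + (X3 \<xi>)\<^sup>2))"
    using x1 xU x3 by auto
  have U0: "U \<xi> \<ge> 0" for \<xi> using U[of \<xi>] zero_le_power2 order_trans by blast
  have "(\<integral>\<^sup>+\<xi>. ennreal ((?err \<xi>)\<^sup>2) \<partial>\<Q>) \<le> (\<integral>\<^sup>+\<xi>. ennreal (3 * ((X1 \<xi>)\<^sup>2 + U \<xi> + (X3 \<xi>)\<^sup>2)) \<partial>\<Q>)"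
  proof (intro nn_integral_mono ennreal_leI)
    fix \<xi>
    show "(?err \<xi>)\<^sup>2 \<le> 3 * ((X1 \<xi>)\<^sup>2 + U \<xi> + (X3 \<xi>)\<^sup>2)"
      unfolding err by (rule three[OF U])
  qed
  also have "\<dots> = ennreal (LINT \<xi>|\<Q>. 3 * ((X1 \<xi>)\<^sup>2 + U \<xi> + (X3 \<xi>)\<^sup>2))"
    by (rule nn_integral_eq_integral[OF int]) (simp add: U0)
  also have "\<dots> \<le> ennreal ?rhs"
  proof (rule ennreal_leI)
    have "(LINT \<xi>|\<Q>. 3 * ((X1 \<xi>)\<^sup>2 + U \<xi> + (X3 \<xi>)\<^sup>2))
        = 3 * ((LINT \<xi>|\<Q>. (X1 \<xi>)\<^sup>2) + (LINT \<xi>|\<Q>. U \<xi>) + (LINT \<xi>|\<Q>. (X3 \<xi>)\<^sup>2))"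
      using x1 xU x3 by simp
    also have "\<dots> \<le> 3 * (\<sigma>\<^sup>2 * (exp 1 * V) + \<sigma>\<^sup>2 * ((16 * \<tau>\<^sup>2 + 2) * (lam * real s)\<^sup>2)
        + \<sigma>\<^sup>2 * ((K / 2 + 1) * V + (K + 1) / 2 * lam\<^sup>2 * (real d * exp (- real m / 2))))"
      using x1_le xU_le x3_le by simp
    also have "\<dots> = ?rhs" by (simp add: algebra_simps)
    finally show "(LINT \<xi>|\<Q>. 3 * ((X1 \<xi>)\<^sup>2 + U \<xi> + (X3 \<xi>)\<^sup>2)) \<le> ?rhs" .
  qed
  finally show ?thesis .
qed

end

section \<open>The rate\<close>

text \<open>As \<eta> has nonincreasing absolute values, the indices with large coefficients form an
  initial segment, and its maximum separates the two regimes. The inserted 0 stands for the empty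
  segment.\<close>

lemma cutoff_index_properties:
  fixes \<eta> :: "nat \<Rightarrow> real" and \<alpha> :: real and d s :: nat
  assumes mono: "\<And>i j. i \<in> {1..d} \<Longrightarrow> j \<in> {1..d} \<Longrightarrow> i \<le> j \<Longrightarrow> \<bar>\<eta> j\<bar> \<le> \<bar>\<eta> i\<bar>"
  defines "c \<equiv> cutoff_index \<alpha> \<eta> d s"
  shows "c \<le> d"
    and "j \<in> {1..c} \<Longrightarrow> rate_lambda \<alpha> \<eta> d s \<le> \<bar>\<eta> j\<bar>"
    and "j \<in> {c<..d} \<Longrightarrow> \<bar>\<eta> j\<bar> < rate_lambda \<alpha> \<eta> d s"
proof -
  let ?A = "{j \<in> {1..d}. rate_lambda \<alpha> \<eta> d s \<le> \<bar>\<eta> j\<bar>}"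
  have c: "c = Max (insert 0 ?A)" by (simp add: c_def cutoff_index_def)
  then have mem: "c \<in> insert 0 ?A" using Max_in[of "insert 0 ?A"] by simp
  then show "c \<le> d" by auto
  show "rate_lambda \<alpha> \<eta> d s \<le> \<bar>\<eta> j\<bar>" if "j \<in> {1..c}"
    using that mem mono[of j c] by auto
  show "\<bar>\<eta> j\<bar> < rate_lambda \<alpha> \<eta> d s" if "j \<in> {c<..d}"
  proof (rule ccontr)
    assume "\<not> \<bar>\<eta> j\<bar> < rate_lambda \<alpha> \<eta> d s"
    then have "j \<in> insert 0 ?A" using that by auto
    then have "j \<le> c" unfolding c by (intro Max_ge) auto
    then show False using that by simp
  qed
qed

text \<open>One comparison for each kind of term in \<open>risk_le\<close>: the sum is
  \<open>rate_nu\<close> squared, and the third bound, for the bad event, follows from the second by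
  \<open>1 \<le> s\<close>.\<close>

lemma rate_Phi_ge:
  assumes "1 \<le> s"
  shows "(\<Sum>j=1..d. (\<eta> j)\<^sup>2 * exp (- ((rate_lambda \<alpha> \<eta> d s / \<bar>\<eta> j\<bar>) powr \<alpha>))) \<le> rate_Phi \<alpha> \<eta> d s"
    and "(rate_lambda \<alpha> \<eta> d s * real s)\<^sup>2 \<le> rate_Phi \<alpha> \<eta> d s"
    and "(rate_lambda \<alpha> \<eta> d s)\<^sup>2 \<le> rate_Phi \<alpha> \<eta> d s"
proof -
  let ?lam = "rate_lambda \<alpha> \<eta> d s" and ?nu = "rate_nu \<alpha> \<eta> d s"
  let ?V = "\<Sum>j=1..d. (\<eta> j)\<^sup>2 * exp (- ((?lam / \<bar>\<eta> j\<bar>) powr \<alpha>))"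
  have lam: "?lam \<ge> 0" by (simp add: rate_lambda_def)
  have "?V \<ge> 0" by (simp add: sum_nonneg)
  then have nu: "?nu \<ge> 0" "?nu\<^sup>2 = ?V" by (simp_all add: rate_nu_def)
  show "?V \<le> rate_Phi \<alpha> \<eta> d s"
    unfolding nu(2)[symmetric] rate_Phi_def using lam nu(1) by (intro power_mono) auto
  show 2: "(?lam * real s)\<^sup>2 \<le> rate_Phi \<alpha> \<eta> d s"
    unfolding rate_Phi_def using lam nu(1) by (intro power_mono) auto
  have "?lam * 1 \<le> ?lam * real s" using lam assms by (intro mult_left_mono) auto
  then have "?lam\<^sup>2 \<le> (?lam * real s)\<^sup>2" using lam by (intro power_mono) auto
  with 2 show "?lam\<^sup>2 \<le> rate_Phi \<alpha> \<eta> d s" by linarith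
qed

text \<open>With \<open>d div N\<close> blocks, the failure probability is small enough to absorb a
  sum over all \<open>d\<close> coordinates: \<open>d < N * (d div N + 1)\<close>, and
  \<open>m + 1 \<le> 2 * exp (m / 2)\<close>.\<close>

lemma times_exp_quotient_le:
  fixes N :: nat
  assumes "N > 0"
  shows "real d * exp (- real (d div N) / 2) \<le> 2 * real N"
proof -
  let ?m = "d div N"
  have "d < N * (?m + 1)"
    using assms by (metis Suc_eq_plus1 dividend_less_times_div mult_Suc_right add.commute)
  then have "real d \<le> real N * (real ?m + 1)"
    by (metis less_imp_le of_nat_1 of_nat_add of_nat_le_iff of_nat_mult)
  also have "real ?m + 1 \<le> 2 * exp (real ?m / 2)"
    using exp_ge_add_one_self[of "real ?m / 2"] by linarith
  finally have "real d \<le> real N * (2 * exp (real ?m / 2))" by (simp add: mult_left_mono)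
  then have "real d * exp (- real ?m / 2) \<le> real N * (2 * exp (real ?m / 2)) * exp (- real ?m / 2)"
    by (rule mult_right_mono) simp
  also have "\<dots> = 2 * real N" by (simp add: exp_minus)
  finally show ?thesis .
qed

theorem theorem7:
  fixes \<alpha> \<tau> :: real
  assumes "\<alpha> > 0" and "\<tau> > 0"
  shows "\<exists>\<gamma> C :: real. 0 < \<gamma> \<and> \<gamma> \<le> 1 / 2 \<and> C > 0 \<and>
    (\<forall>(d::nat) (\<eta> :: nat \<Rightarrow> real) (\<sigma>::real) (s::nat) (B :: nat \<Rightarrow> nat set).
      d \<ge> 1
      \<longrightarrow> (\<forall>i\<in>{1..d}. \<forall>j\<in>{1..d}. i \<le> j \<longrightarrow> \<bar>\<eta> j\<bar> \<le> \<bar>\<eta> i\<bar>) \<and> \<bar>\<eta> d\<bar> > 0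
      \<longrightarrow> \<sigma> > 0
      \<longrightarrow> 1 \<le> s \<and> real s < real_of_int \<lfloor>\<gamma> * real d\<rfloor> / 4
      \<longrightarrow> block_partition d (nat \<lfloor>\<gamma> * real d\<rfloor>) B
      \<longrightarrow> (SUP \<theta>\<in>sparse_vectors d s. SUP Q\<in>product_noise_class \<alpha> \<tau> d.
            \<integral>\<^sup>+ \<xi>. ennreal ((L_hat \<alpha> \<tau> \<eta> d s (nat \<lfloor>\<gamma> * real d\<rfloor>) B (observation \<sigma> \<theta> \<xi>)
                          - linear_functional \<eta> d \<theta>)\<^sup>2) \<partial>Q)
          \<le> ennreal (C * \<sigma>\<^sup>2 * rate_Phi \<alpha> \<eta> d s))"
proof -
  obtain K where K: "1 \<le> K"
    "\<And>P. P \<in> noise_class \<alpha> \<tau> \<Longrightarrow> integrable P (\<lambda>w. w ^ 4)"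
    "\<And>P. P \<in> noise_class \<alpha> \<tau> \<Longrightarrow> (LINT w|P. w ^ 4) \<le> K"
    using noise_class_fourth_moment[OF assms] by blast
  \<comment> \<open>The witness for \<gamma> is \<open>1 / N\<close>: there are then
    \<open>d div N\<close> blocks, and each has at least \<open>N \<ge> 128 * K\<close>
    points.\<close>
  define N where "N = nat \<lceil>128 * K\<rceil>"
  have N: "128 * K \<le> real N" by (simp add: N_def real_nat_ceiling_ge)
  have N2: "N \<ge> 2" using N K(1) by linarith
  \<comment> \<open>The summands belong to the weighted sum, the support and the bad event; the last
    one is \<open>(K + 1) / 2\<close> times the bound \<open>2 * N\<close> of
    \<open>times_exp_quotient_le\<close>.\<close>
  define C where "C = 3 * ((exp 1 + K / 2 + 1) + (16 * \<tau>\<^sup>2 + 2) + (K + 1) * real N)"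
  have C: "C > 0" using K(1) by (simp add: C_def add_pos_nonneg)
  have m_eq: "nat \<lfloor>1 / real N * real d\<rfloor> = d div N" for d
    using floor_divide_of_nat_eq[of d N, where 'a = real] by simp
  have risk: "(\<integral>\<^sup>+ \<xi>. ennreal ((L_hat \<alpha> \<tau> \<eta> d s (d div N) B (observation \<sigma> \<theta> \<xi>)
        - linear_functional \<eta> d \<theta>)\<^sup>2) \<partial>Q) \<le> ennreal (C * \<sigma>\<^sup>2 * rate_Phi \<alpha> \<eta> d s)"
    if mono: "\<forall>i\<in>{1..d}. \<forall>j\<in>{1..d}. i \<le> j \<longrightarrow> \<bar>\<eta> j\<bar> \<le> \<bar>\<eta> i\<bar>" and last: "\<bar>\<eta> d\<bar> > 0" and "d \<ge> 1" "\<sigma> > 0"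
      and s: "1 \<le> s" "4 * s < d div N" and B: "block_partition d (d div N) B"
      and \<theta>: "\<theta> \<in> sparse_vectors d s" and Q: "Q \<in> product_noise_class \<alpha> \<tau> d"
    for d \<eta> \<sigma> s B \<theta> Q
  proof -
    let ?m = "d div N" and ?lam = "rate_lambda \<alpha> \<eta> d s" and ?c = "cutoff_index \<alpha> \<eta> d s"
    let ?Phi = "rate_Phi \<alpha> \<eta> d s"
    obtain P0 where P0: "Q = PiM {1..d} P0" "\<And>j. j \<in> {1..d} \<Longrightarrow> P0 j \<in> noise_class \<alpha> \<tau>"
      using Q unfolding product_noise_class_def by blast
    \<comment> \<open>Indices outside \<open>{1..d}\<close> receive the law of coordinate 1, which
      exists as \<open>d \<ge> 1\<close>; the product measure is unchanged.\<close>
    define P where "P j = (if j \<in> {1..d} then P0 j else P0 1)" for j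
    have P: "P j \<in> noise_class \<alpha> \<tau>" for j using P0(2) \<open>d \<ge> 1\<close> by (simp add: P_def)
    have QP: "Q = PiM {1..d} P" unfolding P0(1) by (rule PiM_cong) (simp_all add: P_def)
    \<comment> \<open>This is \<open>N * (d div N) \<le> d\<close>; the number of blocks is positive
      because it exceeds \<open>4 * s\<close>.\<close>
    have "N \<le> d div ?m"
      using s by (subst less_eq_div_iff_mult_less_eq) (simp_all add: mult.commute div_times_less_eq_dividend)
    then have "128 * K \<le> real (d div ?m)" using N by linarith
    then interpret sparse_observation P d \<alpha> \<tau> K \<theta> \<sigma> s ?m B
      by unfold_locales (use P K s B \<theta> \<open>\<sigma> > 0\<close> in auto)
    have nz: "\<eta> j \<noteq> 0" if "j \<in> {1..d}" for j
      using mono last that \<open>d \<ge> 1\<close> by fastforce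
    have lam: "?lam \<ge> 0" by (simp add: rate_lambda_def)
    have cutoff: "?c \<le> d" "\<And>j. j \<in> {1..?c} \<Longrightarrow> ?lam \<le> \<bar>\<eta> j\<bar>"
      "\<And>j. j \<in> {?c<..d} \<Longrightarrow> \<bar>\<eta> j\<bar> < ?lam"
      using mono by (blast intro: cutoff_index_properties)+
    have "(\<integral>\<^sup>+ \<xi>. ennreal ((L_hat \<alpha> \<tau> \<eta> d s ?m B (observation \<sigma> \<theta> \<xi>) - linear_functional \<eta> d \<theta>)\<^sup>2) \<partial>Q)
        \<le> ennreal (3 * \<sigma>\<^sup>2 * ((exp 1 + K / 2 + 1)
            * (\<Sum>j=1..d. (\<eta> j)\<^sup>2 * exp (- ((?lam / \<bar>\<eta> j\<bar>) powr \<alpha>)))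
          + (16 * \<tau>\<^sup>2 + 2) * (?lam * real s)\<^sup>2 + (K + 1) / 2 * ?lam\<^sup>2 * (real d * exp (- real ?m / 2))))"
      unfolding QP L_hat_def sigma_hat_eq threshold_def[symmetric]
      by (rule risk_le[where \<eta> = \<eta>]; (fact assms lam cutoff nz)?)
    also have "\<dots> \<le> ennreal (3 * \<sigma>\<^sup>2 * ((exp 1 + K / 2 + 1) * ?Phi + (16 * \<tau>\<^sup>2 + 2) * ?Phi + (K + 1) / 2 * ?Phi * (2 * real N)))"
    proof (intro ennreal_leI mult_left_mono add_mono)
      note Phi = rate_Phi_ge[where \<alpha> = \<alpha> and \<eta> = \<eta> and d = d, OF s(1)]
      show "(\<Sum>j=1..d. (\<eta> j)\<^sup>2 * exp (- ((?lam / \<bar>\<eta> j\<bar>) powr \<alpha>))) \<le> ?Phi"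
        and "(?lam * real s)\<^sup>2 \<le> ?Phi"
        by (rule Phi)+
      have "(K + 1) / 2 * ?lam\<^sup>2 \<le> (K + 1) / 2 * ?Phi"
        using K(1) by (intro mult_left_mono Phi) simp
      moreover have "real d * exp (- real ?m / 2) \<le> 2 * real N"
        using N2 by (intro times_exp_quotient_le) simp
      moreover have "0 \<le> (K + 1) / 2 * ?Phi"
        using K(1) by (intro mult_nonneg_nonneg) (simp_all add: rate_Phi_def)
      ultimately show "(K + 1) / 2 * ?lam\<^sup>2 * (real d * exp (- real ?m / 2)) \<le> (K + 1) / 2 * ?Phi * (2 * real N)"
        by (rule mult_mono) simp
    qed (use K(1) in auto)
    also have "3 * \<sigma>\<^sup>2 * ((exp 1 + K / 2 + 1) * ?Phi + (16 * \<tau>\<^sup>2 + 2) * ?Phi + (K + 1) / 2 * ?Phi * (2 * real N))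
        = C * \<sigma>\<^sup>2 * ?Phi"
      by (simp add: C_def algebra_simps)
    finally show ?thesis .
  qed
  show ?thesis
  proof (rule exI[of _ "1 / real N"], rule exI[of _ C], intro conjI allI impI, goal_cases)
    case (4 d \<eta> \<sigma> s B)
    have floor: "real_of_int \<lfloor>1 / real N * real d\<rfloor> = real (d div N)"
      using floor_divide_of_nat_eq[of d N, where 'a = real] by simp
    have "4 * s < d div N" using 4(4) unfolding floor by linarith
    with 4 show ?case unfolding m_eq by (intro SUP_least risk) auto
  qed (use N2 C in auto)
qed

end
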